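(* Let $(A,\cdot,[-,-])$ be a Jacobi algebra with unit $1_A$ and let $(A,\cdot,[-,-],\mathrm{ad}(1_A))$ be the corresponding unital relative Poisson algebra. Let $r\in A\otimes A$ and let $\Delta,\delta:A\to A\otimes A$ be the linear maps defined by $$\Delta(x)=(\mathrm{id}\otimes\mathcal L(x)-\mathcal L(x)\otimes\mathrm{id})r,\qquad \delta(x)=(\mathrm{ad}(x)\otimes\mathrm{id}+\mathrm{id}\otimes\mathrm{ad}(x))r,\qquad x\in A.$$ If $r$ is an antisymmetric solution of the $Q$-RPYBE with $Q=-\mathrm{ad}(1_A)$ in the relative Poisson algebra $(A,\cdot,[-,-],\mathrm{ad}(1_A))$, then $(A,\cdot,[-,-],\Delta,\delta,\mathrm{ad}(1_A),-\mathrm{ad}(1_A))$ is a coboundary relative Poisson bialgebra, and hence the induced relative Poisson algebra $(A\bowtie A^*,\mathrm{ad}(1_A)-(\mathrm{ad}(1_A))^* )$ with the bilinear form $$\mathcal B_d(x+a^*,y+b^* )=\langle x,b^*\rangle+\langle a^*,y\rangle,\qquad x,y\in A,\ a^*,b^*\in A^*,$$ is a Frobenius Jacobi algebra.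
   Context: All vector spaces are finite-dimensional over an algebraically closed field $\mathbb K$ of characteristic zero. Jacobi algebra. A triple $(A,\cdot,[-,-])$ with $(A,\cdot)$ a unital commutative associative algebra with unit $1_A$, $(A,[-,-])$ a Lie algebra, and $[z,x\cdot y]=[z,x]\cdot y+x\cdot[z,y]+x\cdot y\cdot[1_A,z]$ for all $x,y,z$. It is Frobenius if there is a nondegenerate symmetric bilinear form $\mathcal B$ on $A$ with $\mathcal B(x\cdot y,z)=\mathcal B(x,y\cdot z)$ and $\mathcal B([x,y],z)=\mathcal B(x,[y,z])$. Relative Poisson algebra. $(A,\cdot,[-,-],P)$, abbreviated $(A,P)$: $(A,\cdot)$ is a commutative associative (not necessarily unital) algebra, $(A,[-,-])$ is a Lie algebra, $P:A\to A$ is a linear map that is a derivation of both $\cdot$ and $[-,-]$, and $[z,x\cdot y]=[z,x]\cdot y+x\cdot[z,y]+x\cdot y\cdot P(z)$. It is unital if $(A,\cdot)$ is unital. Jacobi algebras correspond one-to-one to unital relative Poisson algebras via $P=\mathrm{ad}(1_A)$. Notation. $\mathcal L(x)y=x\cdot y$, $\mathrm{ad}(x)y=[x,y]$ (with subscripts $A$, $A^*$ indicating the algebra), $\tau(x\otimes y)=y\otimes x$. For a linear map $\varphi:A\to\mathrm{End}(V)$, $\varphi^*:A\to\mathrm{End}(V^* )$ is $\langle\varphi^*(x)u^*,v\rangle=-\langle u^*,\varphi(x)v\rangle$ (with a sign). For a linear map $T:V_1\to V_2$ between vector spaces, $T^*:V_2^*\to V_1^*$ is the usual dual map (no sign); in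 particular $(\mathrm{ad}(1_A))^*$ is the usual dual of the map $\mathrm{ad}(1_A):A\to A$. For linear maps $\phi_i$ on $V_i$, $\phi_1+\phi_2$ is the map $v_1+v_2\mapsto\phi_1(v_1)+\phi_2(v_2)$. RPYBE. For $r=\sum_ia_i\otimes b_i\in A\otimes A$ and a bilinear operation $\diamond$: $r_{12}\diamond r_{13}=\sum a_i\diamond a_j\otimes b_i\otimes b_j$, $r_{12}\diamond r_{23}=\sum a_i\otimes b_i\diamond a_j\otimes b_j$, $r_{13}\diamond r_{23}=\sum a_i\otimes a_j\otimes b_i\diamond b_j$. For a linear map $Q:A\to A$, $r$ is a solution of the $Q$-RPYBE in $(A,P)$ if $r_{12}\cdot r_{13}-r_{12}\cdot r_{23}+r_{13}\cdot r_{23}=0$, $[r_{12},r_{13}]+[r_{12},r_{23}]+[r_{13},r_{23}]=0$, $(P\otimes\mathrm{id}-\mathrm{id}\otimes Q)r=0$ and $(Q\otimes\mathrm{id}-\mathrm{id}\otimes P)r=0$. $r$ is antisymmetric if $r+\tau(r)=0$. A linear map $Q:A\to A$ dually represents $(A,P)$ if $x\cdot Q(y)-P(x)\cdot y-Q(x\cdot y)=0$, $[x,Q(y)]-[P(x),y]-Q([x,y])=0$, $[x,y\cdot z]+[y,z\cdot x]+[z,x\cdot y]+Q(x\cdot y\cdot z)=0$ for all $x,y,z\in A$. Relative Poisson coalgebra $(A,\Delta,\delta,Q)$. Linear maps $\Delta,\delta:A\to A\otimes A$, $Q:A\to A$ with $\tau\Delta=\Delta$, $(\mathrm{id}\otimes\Delta)\Delta=(\Delta\otimes\mathrm{id})\Delta$;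 $\tau\delta=-\delta$, $(\mathrm{id}+\xi+\xi^2)(\mathrm{id}\otimes\delta)\delta=0$ where $\xi(x\otimes y\otimes z)=y\otimes z\otimes x$; $\Delta Q=(Q\otimes\mathrm{id}+\mathrm{id}\otimes Q)\Delta$; $\delta Q=(Q\otimes\mathrm{id}+\mathrm{id}\otimes Q)\delta$; and $(\mathrm{id}\otimes\Delta)\delta(x)-(\delta\otimes\mathrm{id})\Delta(x)-(\tau\otimes\mathrm{id})(\mathrm{id}\otimes\delta)\Delta(x)-(Q\otimes\mathrm{id}\otimes\mathrm{id})(\Delta\otimes\mathrm{id})\Delta(x)=0$ for all $x\in A$. Relative Poisson bialgebra $(A,\cdot,[-,-],\Delta,\delta,P,Q)$. $(A,\cdot,[-,-],P)$ is a relative Poisson algebra; $(A,\Delta,\delta,Q)$ is a relative Poisson coalgebra; $Q$ dually represents $(A,P)$; $\Delta P=(P\otimes\mathrm{id}-\mathrm{id}\otimes Q)\Delta$, $\delta P=(P\otimes\mathrm{id}-\mathrm{id}\otimes Q)\delta$, $(\Delta\otimes\mathrm{id})\Delta(P+Q)=0$; and for all $x,y\in A$: $\Delta(x\cdot y)=(\mathcal L(x)\otimes\mathrm{id})\Delta(y)+(\mathrm{id}\otimes\mathcal L(y))\Delta(x)$; $\delta([x,y])=(\mathrm{ad}(x)\otimes\mathrm{id}+\mathrm{id}\otimes\mathrm{ad}(x))\delta(y)-(\mathrm{ad}(y)\otimes\mathrm{id}+\mathrm{id}\otimes\mathrm{ad}(y))\delta(x)$; $\delta(x\cdot y)-(\mathrm{id}\otimes\mathrm{ad}(y))\Delta(x)-(\mathcal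 L(x)\otimes\mathrm{id})\delta(y)-(\mathrm{id}\otimes\mathrm{ad}(x))\Delta(y)-(\mathcal L(y)\otimes\mathrm{id})\delta(x)-(\mathrm{id}\otimes Q)\Delta(x\cdot y)=0$; $\Delta([x,y])-(\mathcal L(y)\otimes\mathrm{id})\delta(x)-(\mathrm{id}\otimes\mathrm{ad}(x))\Delta(y)+(\mathrm{id}\otimes\mathcal L(y))\delta(x)-(\mathrm{ad}(x)\otimes\mathrm{id})\Delta(y)+\Delta(P(x)\cdot y)=0$. It is coboundary if $\Delta,\delta$ are given by some $r\in A\otimes A$ through the formulas displayed in the claim. Induced relative Poisson algebra. For a relative Poisson bialgebra, $A^*$ is a relative Poisson algebra with $a^*\cdot_{A^*}b^*=\Delta^*(a^*\otimes b^* )$, $[a^*,b^*]_{A^*}=\delta^*(a^*\otimes b^* )$ and derivation $Q^*$. The induced relative Poisson algebra $(A\bowtie A^*,P+Q^* )$ is $A\oplus A^*$ with $(x+a^* )\cdot(y+b^* )=x\cdot_Ay-\mathcal L_{A^*}^*(a^* )y-\mathcal L_{A^*}^*(b^* )x+a^*\cdot_{A^*}b^*-\mathcal L_A^*(x)b^*-\mathcal L_A^*(y)a^*$, $[x+a^*,y+b^*]=[x,y]_A+\mathrm{ad}_{A^*}^*(a^* )y-\mathrm{ad}_{A^*}^*(b^* )x+[a^*,b^*]_{A^*}+\mathrm{ad}_A^*(x)b^*-\mathrm{ad}_A^*(y)a^*$, and derivation $P+Q^*$ (which is a relative Poisson algebra). *)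

theory Defs
  imports
    "HOL-Computational_Algebra.Polynomial"
    "HOL-Library.Function_Algebras"
    "HOL-Library.Product_Plus"
begin

section \<open>Algebras on finite-dimensional spaces\<close>

text \<open>
  The carrier \<open>V\<close> is a subspace of a type. It is \<open>UNIV\<close> for the given algebra \<open>A\<close>; a proper
  carrier is needed for \<open>A \<oplus> A\<^sup>*\<close>, since \<open>A\<^sup>*\<close> is the set of linear elements of \<open>'a \<Rightarrow> 'k\<close>.
\<close>

locale fd_space_on = vector_space scale
  for scale :: "'k::field \<Rightarrow> 'v::ab_group_add \<Rightarrow> 'v" +
  fixes V :: "'v set"
  assumes fin_dim: "\<exists>B. finite B \<and> span B = V"

locale bilinear_op_on = fd_space_on scale V
  for scale :: "'k::field \<Rightarrow> 'v::ab_group_add \<Rightarrow> 'v" and V +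
  fixes prd :: "'v \<Rightarrow> 'v \<Rightarrow> 'v"
  assumes closed: "\<lbrakk>x \<in> V; y \<in> V\<rbrakk> \<Longrightarrow> prd x y \<in> V"
    and add_left: "\<lbrakk>x \<in> V; y \<in> V; z \<in> V\<rbrakk> \<Longrightarrow> prd (x + y) z = prd x z + prd y z"
    and add_right: "\<lbrakk>x \<in> V; y \<in> V; z \<in> V\<rbrakk> \<Longrightarrow> prd x (y + z) = prd x y + prd x z"
    and scale_left: "\<lbrakk>x \<in> V; y \<in> V\<rbrakk> \<Longrightarrow> prd (scale c x) y = scale c (prd x y)"
    and scale_right: "\<lbrakk>x \<in> V; y \<in> V\<rbrakk> \<Longrightarrow> prd x (scale c y) = scale c (prd x y)"

locale comm_assoc_algebra_on = bilinear_op_on scale V mul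
  for scale :: "'k::field \<Rightarrow> 'v::ab_group_add \<Rightarrow> 'v" and V mul +
  assumes mul_commute: "\<lbrakk>x \<in> V; y \<in> V\<rbrakk> \<Longrightarrow> mul x y = mul y x"
    and mul_assoc: "\<lbrakk>x \<in> V; y \<in> V; z \<in> V\<rbrakk> \<Longrightarrow> mul (mul x y) z = mul x (mul y z)"

locale lie_algebra_on = bilinear_op_on scale V br
  for scale :: "'k::field \<Rightarrow> 'v::ab_group_add \<Rightarrow> 'v" and V br +
  assumes br_self: "x \<in> V \<Longrightarrow> br x x = 0"
    and jacobi: "\<lbrakk>x \<in> V; y \<in> V; z \<in> V\<rbrakk> \<Longrightarrow>
      br x (br y z) + br y (br z x) + br z (br x y) = 0"

locale jacobi_algebra_on =
  mult: comm_assoc_algebra_on scale V mul + lie: lie_algebra_on scale V br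
  for scale :: "'k::field \<Rightarrow> 'v::ab_group_add \<Rightarrow> 'v" and V mul br +
  fixes one :: 'v
  assumes one_closed: "one \<in> V"
    and one_left: "x \<in> V \<Longrightarrow> mul one x = x"
    and jacobi_leibniz: "\<lbrakk>x \<in> V; y \<in> V; z \<in> V\<rbrakk> \<Longrightarrow>
      br z (mul x y) = mul (br z x) y + mul x (br z y) + mul (mul x y) (br one z)"

locale frobenius_jacobi_algebra_on = jacobi_algebra_on scale V mul br one
  for scale :: "'k::field \<Rightarrow> 'v::ab_group_add \<Rightarrow> 'v" and V mul br one +
  fixes B :: "'v \<Rightarrow> 'v \<Rightarrow> 'k"
  assumes form_add: "\<lbrakk>x \<in> V; y \<in> V; z \<in> V\<rbrakk> \<Longrightarrow> B (x + y) z = B x z + B y z"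
    and form_scale: "\<lbrakk>x \<in> V; y \<in> V\<rbrakk> \<Longrightarrow> B (scale c x) y = c * B x y"
    and form_sym: "\<lbrakk>x \<in> V; y \<in> V\<rbrakk> \<Longrightarrow> B x y = B y x"
    and form_nondegenerate: "\<lbrakk>x \<in> V; \<And>y. y \<in> V \<Longrightarrow> B x y = 0\<rbrakk> \<Longrightarrow> x = 0"
    and form_mul: "\<lbrakk>x \<in> V; y \<in> V; z \<in> V\<rbrakk> \<Longrightarrow> B (mul x y) z = B x (mul y z)"
    and form_br: "\<lbrakk>x \<in> V; y \<in> V; z \<in> V\<rbrakk> \<Longrightarrow> B (br x y) z = B x (br y z)"

locale relative_poisson_algebra_on =
  mult: comm_assoc_algebra_on scale V mul + lie: lie_algebra_on scale V br
  for scale :: "'k::field \<Rightarrow> 'v::ab_group_add \<Rightarrow> 'v" and V mul br +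
  fixes P :: "'v \<Rightarrow> 'v"
  assumes P_closed: "x \<in> V \<Longrightarrow> P x \<in> V"
    and P_add: "\<lbrakk>x \<in> V; y \<in> V\<rbrakk> \<Longrightarrow> P (x + y) = P x + P y"
    and P_scale: "x \<in> V \<Longrightarrow> P (scale c x) = scale c (P x)"
    and P_mul: "\<lbrakk>x \<in> V; y \<in> V\<rbrakk> \<Longrightarrow> P (mul x y) = mul (P x) y + mul x (P y)"
    and P_br: "\<lbrakk>x \<in> V; y \<in> V\<rbrakk> \<Longrightarrow> P (br x y) = br (P x) y + br x (P y)"
    and relative_leibniz: "\<lbrakk>x \<in> V; y \<in> V; z \<in> V\<rbrakk> \<Longrightarrow>
      br z (mul x y) = mul (br z x) y + mul x (br z y) + mul (mul x y) (P z)"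

section \<open>Tensor products\<close>

text \<open>
  A tensor \<open>\<Sum>\<^sub>i a\<^sub>i \<otimes> b\<^sub>i\<close> is represented by the functional \<open>\<beta> \<mapsto> \<Sum>\<^sub>i \<beta>(a\<^sub>i, b\<^sub>i)\<close> on bilinear forms,
  extended by \<open>0\<close> to functions that are not bilinear; similarly for \<open>A \<otimes> A \<otimes> A\<close> and trilinear
  forms. Lemma \<open>tensor2_universal\<close> is the universal property. The guards \<open>if bilinear_form \<dots>\<close> only
  maintain the extension by \<open>0\<close>, so that equality of tensors is equality of functions.
\<close>

definition bilinear_form :: "('k::field \<Rightarrow> 'a::ab_group_add \<Rightarrow> 'a) \<Rightarrow> ('a \<Rightarrow> 'a \<Rightarrow> 'k) \<Rightarrow> bool" where
  "bilinear_form s \<beta> \<longleftrightarrow>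
    (\<forall>y. Vector_Spaces.linear s (*) (\<lambda>x. \<beta> x y)) \<and> (\<forall>x. Vector_Spaces.linear s (*) (\<lambda>y. \<beta> x y))"

definition trilinear_form :: "('k::field \<Rightarrow> 'a::ab_group_add \<Rightarrow> 'a) \<Rightarrow> ('a \<Rightarrow> 'a \<Rightarrow> 'a \<Rightarrow> 'k) \<Rightarrow> bool" where
  "trilinear_form s \<theta> \<longleftrightarrow>
    (\<forall>y z. Vector_Spaces.linear s (*) (\<lambda>x. \<theta> x y z)) \<and>
    (\<forall>x z. Vector_Spaces.linear s (*) (\<lambda>y. \<theta> x y z)) \<and>
    (\<forall>x y. Vector_Spaces.linear s (*) (\<lambda>z. \<theta> x y z))"

type_synonym ('a, 'k) tensor2 = "('a \<Rightarrow> 'a \<Rightarrow> 'k) \<Rightarrow> 'k"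
type_synonym ('a, 'k) tensor3 = "('a \<Rightarrow> 'a \<Rightarrow> 'a \<Rightarrow> 'k) \<Rightarrow> 'k"

definition fun_scale :: "'k::times \<Rightarrow> ('b \<Rightarrow> 'k) \<Rightarrow> 'b \<Rightarrow> 'k" where
  "fun_scale c t = (\<lambda>\<beta>. c * t \<beta>)"

definition pure2 :: "('k::field \<Rightarrow> 'a::ab_group_add \<Rightarrow> 'a) \<Rightarrow> 'a \<Rightarrow> 'a \<Rightarrow> ('a, 'k) tensor2" where
  "pure2 s x y = (\<lambda>\<beta>. if bilinear_form s \<beta> then \<beta> x y else 0)"

definition pure3 :: "('k::field \<Rightarrow> 'a::ab_group_add \<Rightarrow> 'a) \<Rightarrow> 'a \<Rightarrow> 'a \<Rightarrow> 'a \<Rightarrow> ('a, 'k) tensor3" where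
  "pure3 s x y z = (\<lambda>\<theta>. if trilinear_form s \<theta> then \<theta> x y z else 0)"

definition tensors2 :: "('k::field \<Rightarrow> 'a::ab_group_add \<Rightarrow> 'a) \<Rightarrow> ('a, 'k) tensor2 set" where
  "tensors2 s = {\<Sum>i<n. pure2 s (a i) (b i) | (n::nat) a b. True}"

definition tmap2 :: "('k::field \<Rightarrow> 'a::ab_group_add \<Rightarrow> 'a) \<Rightarrow> ('a \<Rightarrow> 'a) \<Rightarrow> ('a \<Rightarrow> 'a) \<Rightarrow>
    ('a, 'k) tensor2 \<Rightarrow> ('a, 'k) tensor2" where \<comment> \<open>\<open>T \<otimes> S\<close>\<close>
  "tmap2 s T S t = (\<lambda>\<beta>. if bilinear_form s \<beta> then t (\<lambda>x y. \<beta> (T x) (S y)) else 0)"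

definition tmap3 :: "('k::field \<Rightarrow> 'a::ab_group_add \<Rightarrow> 'a) \<Rightarrow> ('a \<Rightarrow> 'a) \<Rightarrow> ('a \<Rightarrow> 'a) \<Rightarrow> ('a \<Rightarrow> 'a) \<Rightarrow>
    ('a, 'k) tensor3 \<Rightarrow> ('a, 'k) tensor3" where \<comment> \<open>\<open>T \<otimes> S \<otimes> R\<close>\<close>
  "tmap3 s T S R t = (\<lambda>\<theta>. if trilinear_form s \<theta> then t (\<lambda>x y z. \<theta> (T x) (S y) (R z)) else 0)"

definition flip2 :: "('a, 'k) tensor2 \<Rightarrow> ('a, 'k) tensor2" where
    \<comment> \<open>\<open>\<tau>(x \<otimes> y) = y \<otimes> x\<close>\<close>
  "flip2 t = (\<lambda>\<beta>. t (\<lambda>x y. \<beta> y x))"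

definition flip12 :: "('a, 'k) tensor3 \<Rightarrow> ('a, 'k) tensor3" where
    \<comment> \<open>\<open>(\<tau> \<otimes> id)(x \<otimes> y \<otimes> z) = y \<otimes> x \<otimes> z\<close>\<close>
  "flip12 t = (\<lambda>\<theta>. t (\<lambda>x y z. \<theta> y x z))"

definition cycle3 :: "('a, 'k) tensor3 \<Rightarrow> ('a, 'k) tensor3" where
    \<comment> \<open>\<open>\<xi>(x \<otimes> y \<otimes> z) = y \<otimes> z \<otimes> x\<close>\<close>
  "cycle3 t = (\<lambda>\<theta>. t (\<lambda>x y z. \<theta> y z x))"

definition id_tensor :: "('k::field \<Rightarrow> 'a::ab_group_add \<Rightarrow> 'a) \<Rightarrow> ('a \<Rightarrow> ('a, 'k) tensor2) \<Rightarrow>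
    ('a, 'k) tensor2 \<Rightarrow> ('a, 'k) tensor3" where \<comment> \<open>\<open>id \<otimes> D\<close> for \<open>D : A \<rightarrow> A \<otimes> A\<close>\<close>
  "id_tensor s D t = (\<lambda>\<theta>. if trilinear_form s \<theta> then t (\<lambda>x y. D y (\<lambda>u v. \<theta> x u v)) else 0)"

definition tensor_id :: "('k::field \<Rightarrow> 'a::ab_group_add \<Rightarrow> 'a) \<Rightarrow> ('a \<Rightarrow> ('a, 'k) tensor2) \<Rightarrow>
    ('a, 'k) tensor2 \<Rightarrow> ('a, 'k) tensor3" where \<comment> \<open>\<open>D \<otimes> id\<close> for \<open>D : A \<rightarrow> A \<otimes> A\<close>\<close>
  "tensor_id s D t = (\<lambda>\<theta>. if trilinear_form s \<theta> then t (\<lambda>x y. D x (\<lambda>u v. \<theta> u v y)) else 0)"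

text \<open>
  For \<open>r = \<Sum>\<^sub>i a\<^sub>i \<otimes> b\<^sub>i\<close> these are \<open>r\<^sub>1\<^sub>2 \<diamond> r\<^sub>1\<^sub>3\<close>, \<open>r\<^sub>1\<^sub>2 \<diamond> r\<^sub>2\<^sub>3\<close> and \<open>r\<^sub>1\<^sub>3 \<diamond> r\<^sub>2\<^sub>3\<close>, with
  \<open>(a, b) = (a\<^sub>i, b\<^sub>i)\<close> and \<open>(c, d) = (a\<^sub>j, b\<^sub>j)\<close>; see \<open>prod_sums\<close> below.
\<close>

definition prod_12_13 :: "('k::field \<Rightarrow> 'a::ab_group_add \<Rightarrow> 'a) \<Rightarrow> ('a \<Rightarrow> 'a \<Rightarrow> 'a) \<Rightarrow>
    ('a, 'k) tensor2 \<Rightarrow> ('a, 'k) tensor3" where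
  "prod_12_13 s prd r =
    (\<lambda>\<theta>. if trilinear_form s \<theta> then r (\<lambda>a b. r (\<lambda>c d. \<theta> (prd a c) b d)) else 0)"

definition prod_12_23 :: "('k::field \<Rightarrow> 'a::ab_group_add \<Rightarrow> 'a) \<Rightarrow> ('a \<Rightarrow> 'a \<Rightarrow> 'a) \<Rightarrow>
    ('a, 'k) tensor2 \<Rightarrow> ('a, 'k) tensor3" where
  "prod_12_23 s prd r =
    (\<lambda>\<theta>. if trilinear_form s \<theta> then r (\<lambda>a b. r (\<lambda>c d. \<theta> a (prd b c) d)) else 0)"

definition prod_13_23 :: "('k::field \<Rightarrow> 'a::ab_group_add \<Rightarrow> 'a) \<Rightarrow> ('a \<Rightarrow> 'a \<Rightarrow> 'a) \<Rightarrow>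
    ('a, 'k) tensor2 \<Rightarrow> ('a, 'k) tensor3" where
  "prod_13_23 s prd r =
    (\<lambda>\<theta>. if trilinear_form s \<theta> then r (\<lambda>a b. r (\<lambda>c d. \<theta> a c (prd b d))) else 0)"

section \<open>The relative Poisson Yang--Baxter equation and bialgebras\<close>

definition rpybe_solution :: "('k::field \<Rightarrow> 'a::ab_group_add \<Rightarrow> 'a) \<Rightarrow> ('a \<Rightarrow> 'a \<Rightarrow> 'a) \<Rightarrow>
    ('a \<Rightarrow> 'a \<Rightarrow> 'a) \<Rightarrow> ('a \<Rightarrow> 'a) \<Rightarrow> ('a \<Rightarrow> 'a) \<Rightarrow> ('a, 'k) tensor2 \<Rightarrow> bool" where
  "rpybe_solution s mul br P Q r \<longleftrightarrow>
    prod_12_13 s mul r - prod_12_23 s mul r + prod_13_23 s mul r = 0 \<and>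
    prod_12_13 s br r + prod_12_23 s br r + prod_13_23 s br r = 0 \<and>
    tmap2 s P id r - tmap2 s id Q r = 0 \<and>
    tmap2 s Q id r - tmap2 s id P r = 0"

definition antisymmetric_tensor :: "('a, 'k::field) tensor2 \<Rightarrow> bool" where
  "antisymmetric_tensor r \<longleftrightarrow> r + flip2 r = 0"

definition dually_represents :: "('a::ab_group_add \<Rightarrow> 'a \<Rightarrow> 'a) \<Rightarrow> ('a \<Rightarrow> 'a \<Rightarrow> 'a) \<Rightarrow>
    ('a \<Rightarrow> 'a) \<Rightarrow> ('a \<Rightarrow> 'a) \<Rightarrow> bool" where
  "dually_represents mul br P Q \<longleftrightarrow>
    (\<forall>x y. mul x (Q y) - mul (P x) y - Q (mul x y) = 0) \<and>
    (\<forall>x y. br x (Q y) - br (P x) y - Q (br x y) = 0) \<and>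
    (\<forall>x y z. br x (mul y z) + br y (mul z x) + br z (mul x y) + Q (mul (mul x y) z) = 0)"

locale relative_poisson_coalgebra = fd_space_on scale UNIV
  for scale :: "'k::field \<Rightarrow> 'a::ab_group_add \<Rightarrow> 'a" +
  fixes \<Delta> \<delta> :: "'a \<Rightarrow> ('a, 'k) tensor2" and Q :: "'a \<Rightarrow> 'a"
  assumes \<Delta>_in: "\<Delta> x \<in> tensors2 scale"
    and \<Delta>_linear: "Vector_Spaces.linear scale fun_scale \<Delta>"
    and \<delta>_in: "\<delta> x \<in> tensors2 scale"
    and \<delta>_linear: "Vector_Spaces.linear scale fun_scale \<delta>"
    and Q_linear: "Vector_Spaces.linear scale scale Q"
    and cocommutative: "flip2 (\<Delta> x) = \<Delta> x"
    and coassociative: "id_tensor scale \<Delta> (\<Delta> x) = tensor_id scale \<Delta> (\<Delta> x)"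
    and coantisymmetric: "flip2 (\<delta> x) = - \<delta> x"
    and cojacobi: "id_tensor scale \<delta> (\<delta> x) + cycle3 (id_tensor scale \<delta> (\<delta> x))
      + cycle3 (cycle3 (id_tensor scale \<delta> (\<delta> x))) = 0"
    and \<Delta>_Q: "\<Delta> (Q x) = tmap2 scale Q id (\<Delta> x) + tmap2 scale id Q (\<Delta> x)"
    and \<delta>_Q: "\<delta> (Q x) = tmap2 scale Q id (\<delta> x) + tmap2 scale id Q (\<delta> x)"
    and relative_coleibniz:
      "id_tensor scale \<Delta> (\<delta> x) - tensor_id scale \<delta> (\<Delta> x)
        - flip12 (id_tensor scale \<delta> (\<Delta> x))
        - tmap3 scale Q id id (tensor_id scale \<Delta> (\<Delta> x)) = 0"

locale relative_poisson_bialgebra =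
  alg: relative_poisson_algebra_on scale UNIV mul br P +
  coalg: relative_poisson_coalgebra scale \<Delta> \<delta> Q
  for scale :: "'k::field \<Rightarrow> 'a::ab_group_add \<Rightarrow> 'a" and mul br \<Delta> \<delta> P Q +
  assumes Q_dual: "dually_represents mul br P Q"
    and \<Delta>_P: "\<Delta> (P x) = tmap2 scale P id (\<Delta> x) - tmap2 scale id Q (\<Delta> x)"
    and \<delta>_P: "\<delta> (P x) = tmap2 scale P id (\<delta> x) - tmap2 scale id Q (\<delta> x)"
    and \<Delta>\<Delta>_PQ: "tensor_id scale \<Delta> (\<Delta> (P x + Q x)) = 0"
    and \<Delta>_mul: "\<Delta> (mul x y) = tmap2 scale (mul x) id (\<Delta> y) + tmap2 scale id (mul y) (\<Delta> x)"
    and \<delta>_br: "\<delta> (br x y) =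
      (tmap2 scale (br x) id (\<delta> y) + tmap2 scale id (br x) (\<delta> y))
      - (tmap2 scale (br y) id (\<delta> x) + tmap2 scale id (br y) (\<delta> x))"
    and \<delta>_mul: "\<delta> (mul x y) - tmap2 scale id (br y) (\<Delta> x) - tmap2 scale (mul x) id (\<delta> y)
      - tmap2 scale id (br x) (\<Delta> y) - tmap2 scale (mul y) id (\<delta> x)
      - tmap2 scale id Q (\<Delta> (mul x y)) = 0"
    and \<Delta>_br: "\<Delta> (br x y) - tmap2 scale (mul y) id (\<delta> x) - tmap2 scale id (br x) (\<Delta> y)
      + tmap2 scale id (mul y) (\<delta> x) - tmap2 scale (br x) id (\<Delta> y) + \<Delta> (mul (P x) y) = 0"

definition cobound_\<Delta> :: "('k::field \<Rightarrow> 'a::ab_group_add \<Rightarrow> 'a) \<Rightarrow> ('a \<Rightarrow> 'a \<Rightarrow> 'a) \<Rightarrow>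
    ('a, 'k) tensor2 \<Rightarrow> 'a \<Rightarrow> ('a, 'k) tensor2" where
  "cobound_\<Delta> s mul r x = tmap2 s id (mul x) r - tmap2 s (mul x) id r"

definition cobound_\<delta> :: "('k::field \<Rightarrow> 'a::ab_group_add \<Rightarrow> 'a) \<Rightarrow> ('a \<Rightarrow> 'a \<Rightarrow> 'a) \<Rightarrow>
    ('a, 'k) tensor2 \<Rightarrow> 'a \<Rightarrow> ('a, 'k) tensor2" where
  "cobound_\<delta> s br r x = tmap2 s (br x) id r + tmap2 s id (br x) r"

locale coboundary_relative_poisson_bialgebra =
  relative_poisson_bialgebra scale mul br \<Delta> \<delta> P Q
  for scale :: "'k::field \<Rightarrow> 'a::ab_group_add \<Rightarrow> 'a" and mul br \<Delta> \<delta> P Q +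
  assumes coboundary:
    "\<exists>r\<in>tensors2 scale. \<Delta> = cobound_\<Delta> scale mul r \<and> \<delta> = cobound_\<delta> scale br r"

section \<open>The induced algebra on the sum of a space and its dual\<close>

definition dual_space :: "('k::field \<Rightarrow> 'a::ab_group_add \<Rightarrow> 'a) \<Rightarrow> ('a \<Rightarrow> 'k) set" where
  "dual_space s = {f. Vector_Spaces.linear s (*) f}"

definition transpose_map :: "('a \<Rightarrow> 'b) \<Rightarrow> ('b \<Rightarrow> 'k) \<Rightarrow> 'a \<Rightarrow> 'k" where
  "transpose_map T f = (\<lambda>x. f (T x))"

definition dual_op :: "('a \<Rightarrow> ('a, 'k::times) tensor2) \<Rightarrow> ('a \<Rightarrow> 'k) \<Rightarrow> ('a \<Rightarrow> 'k) \<Rightarrow> 'a \<Rightarrow> 'k" where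
    \<comment> \<open>\<open>D\<^sup>*(f \<otimes> g)\<close>: the functional \<open>f \<otimes> g\<close> on \<open>A \<otimes> A\<close> evaluates a tensor on \<open>(u, v) \<mapsto> f(u) g(v)\<close>\<close>
  "dual_op D f g = (\<lambda>x. D x (\<lambda>u v. f u * g v))"

definition dual_rep :: "('x \<Rightarrow> 'b \<Rightarrow> 'b) \<Rightarrow> 'x \<Rightarrow> ('b \<Rightarrow> 'k::ab_group_add) \<Rightarrow> 'b \<Rightarrow> 'k" where
    \<comment> \<open>\<open>\<langle>\<phi>\<^sup>*(x)u, v\<rangle> = -\<langle>u, \<phi>(x)v\<rangle>\<close>\<close>
  "dual_rep \<phi> x u = (\<lambda>v. - u (\<phi> x v))"

definition from_bidual :: "('k::field \<Rightarrow> 'a::ab_group_add \<Rightarrow> 'a) \<Rightarrow> (('a \<Rightarrow> 'k) \<Rightarrow> 'k) \<Rightarrow> 'a" where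
    \<comment> \<open>inverse of the canonical isomorphism \<open>A \<rightarrow> A\<^sup>*\<^sup>*\<close>, see lemma \<open>from_bidual\<close>\<close>
  "from_bidual s \<Phi> = (THE y. \<forall>f\<in>dual_space s. f y = \<Phi> f)"

definition coadjoint :: "('k::field \<Rightarrow> 'a::ab_group_add \<Rightarrow> 'a) \<Rightarrow>
    (('a \<Rightarrow> 'k) \<Rightarrow> ('a \<Rightarrow> 'k) \<Rightarrow> 'a \<Rightarrow> 'k) \<Rightarrow> ('a \<Rightarrow> 'k) \<Rightarrow> 'a \<Rightarrow> 'a" where
    \<comment> \<open>\<open>\<phi>\<^sup>*(f) : A\<^sup>*\<^sup>* \<rightarrow> A\<^sup>*\<^sup>*\<close> for \<open>\<phi> : A\<^sup>* \<rightarrow> End(A\<^sup>*)\<close>, transported to \<open>A\<close>\<close>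
  "coadjoint s \<phi> f y = from_bidual s (dual_rep \<phi> f (\<lambda>g. g y))"

definition bowtie_space :: "('k::field \<Rightarrow> 'a::ab_group_add \<Rightarrow> 'a) \<Rightarrow> ('a \<times> ('a \<Rightarrow> 'k)) set" where
  "bowtie_space s = UNIV \<times> dual_space s"

definition bowtie_scale :: "('k::field \<Rightarrow> 'a::ab_group_add \<Rightarrow> 'a) \<Rightarrow>
    'k \<Rightarrow> 'a \<times> ('a \<Rightarrow> 'k) \<Rightarrow> 'a \<times> ('a \<Rightarrow> 'k)" where
  "bowtie_scale s c = map_prod (s c) (fun_scale c)"

fun bowtie_mul :: "('k::field \<Rightarrow> 'a::ab_group_add \<Rightarrow> 'a) \<Rightarrow> ('a \<Rightarrow> 'a \<Rightarrow> 'a) \<Rightarrow>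
    ('a \<Rightarrow> ('a, 'k) tensor2) \<Rightarrow> 'a \<times> ('a \<Rightarrow> 'k) \<Rightarrow> 'a \<times> ('a \<Rightarrow> 'k) \<Rightarrow> 'a \<times> ('a \<Rightarrow> 'k)" where
  "bowtie_mul s mul \<Delta> (x, f) (y, g) =
    (mul x y - coadjoint s (dual_op \<Delta>) f y - coadjoint s (dual_op \<Delta>) g x,
     dual_op \<Delta> f g - dual_rep mul x g - dual_rep mul y f)"

fun bowtie_br :: "('k::field \<Rightarrow> 'a::ab_group_add \<Rightarrow> 'a) \<Rightarrow> ('a \<Rightarrow> 'a \<Rightarrow> 'a) \<Rightarrow>
    ('a \<Rightarrow> ('a, 'k) tensor2) \<Rightarrow> 'a \<times> ('a \<Rightarrow> 'k) \<Rightarrow> 'a \<times> ('a \<Rightarrow> 'k) \<Rightarrow> 'a \<times> ('a \<Rightarrow> 'k)" where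
  "bowtie_br s br \<delta> (x, f) (y, g) =
    (br x y + coadjoint s (dual_op \<delta>) f y - coadjoint s (dual_op \<delta>) g x,
     dual_op \<delta> f g + dual_rep br x g - dual_rep br y f)"

fun bowtie_form :: "'a \<times> ('a \<Rightarrow> 'k::plus) \<Rightarrow> 'a \<times> ('a \<Rightarrow> 'k) \<Rightarrow> 'k" where
  "bowtie_form (x, f) (y, g) = g x + f y"

section \<open>Adequacy of the encodings\<close>

lemma vector_space_field: "vector_space ((*) :: 'k::field \<Rightarrow> 'k \<Rightarrow> 'k)"
  by unfold_locales (simp_all add: algebra_simps)

lemma sum_fun_apply: "(\<Sum>i\<in>I. F i) x = (\<Sum>i\<in>I. F i x)"
  for F :: "'i \<Rightarrow> 'x \<Rightarrow> 'k::comm_monoid_add"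
  by (induction I rule: infinite_finite_induct) auto

context vector_space
begin

lemma bilinear_form_alt:
  "bilinear_form scale \<beta> \<longleftrightarrow>
    (\<forall>x y z. \<beta> (x + y) z = \<beta> x z + \<beta> y z) \<and> (\<forall>c x y. \<beta> (scale c x) y = c * \<beta> x y) \<and>
    (\<forall>x y z. \<beta> x (y + z) = \<beta> x y + \<beta> x z) \<and> (\<forall>c x y. \<beta> x (scale c y) = c * \<beta> x y)"
  unfolding bilinear_form_def Vector_Spaces.linear_iff
  using vector_space_axioms vector_space_field by blast

lemma trilinear_form_alt:
  "trilinear_form scale \<theta> \<longleftrightarrow>
    (\<forall>x x' y z. \<theta> (x + x') y z = \<theta> x y z + \<theta> x' y z) \<and> (\<forall>c x y z. \<theta> (scale c x) y z = c * \<theta> x y z) \<and>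
    (\<forall>x y y' z. \<theta> x (y + y') z = \<theta> x y z + \<theta> x y' z) \<and> (\<forall>c x y z. \<theta> x (scale c y) z = c * \<theta> x y z) \<and>
    (\<forall>x y z z'. \<theta> x y (z + z') = \<theta> x y z + \<theta> x y z') \<and> (\<forall>c x y z. \<theta> x y (scale c z) = c * \<theta> x y z)"
  unfolding trilinear_form_def Vector_Spaces.linear_iff
  by (intro iffI; simp add: vector_space_axioms vector_space_field)

lemma fun_scale_vector_space: "vector_space (fun_scale :: 'a \<Rightarrow> ('c \<Rightarrow> 'a) \<Rightarrow> 'c \<Rightarrow> 'a)"
  by unfold_locales (auto simp: fun_scale_def fun_eq_iff algebra_simps)

lemma dual_separates:
  assumes "\<And>f. f \<in> dual_space scale \<Longrightarrow> f x = f y"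
  shows "x = y"
proof (rule ccontr)
  assume "x \<noteq> y"
  interpret p: vector_space_pair scale "(*) :: 'a \<Rightarrow> 'a \<Rightarrow> 'a"
    by (intro vector_space_pair.intro vector_space_axioms vector_space_field)
  have ind: "independent {x - y}"
    using \<open>x \<noteq> y\<close> by simp
  let ?f = "p.construct {x - y} (\<lambda>_. 1)"
  interpret f: Vector_Spaces.linear scale "(*)" ?f
    by (rule p.linear_construct[OF ind])
  have "?f (x - y) = 1"
    by (rule p.construct_basis[OF ind]) simp
  moreover have "?f x = ?f y"
    by (rule assms) (simp add: dual_space_def f.linear_axioms)
  ultimately show False
    by (simp add: f.diff)
qed

text \<open>Every bilinear map \<open>h\<close> factors linearly through \<open>\<otimes>\<close>: the value of \<open>H\<close> on a sum of pure
  tensors is determined by \<open>h\<close> and does not depend on the presentation.\<close>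

lemma tensor2_universal:
  fixes h :: "'b \<Rightarrow> 'b \<Rightarrow> 'c::ab_group_add" and s' :: "'a \<Rightarrow> 'c \<Rightarrow> 'c"
  assumes "vector_space s'"
    and "\<And>y. Vector_Spaces.linear scale s' (\<lambda>x. h x y)"
    and "\<And>x. Vector_Spaces.linear scale s' (h x)"
  shows "\<exists>H. \<forall>(n::nat) a b. H (\<Sum>i<n. pure2 scale (a i) (b i)) = (\<Sum>i<n. h (a i) (b i))"
proof -
  interpret U: vector_space s' by fact
  have wd: "(\<Sum>i<n. h (a i) (b i)) = (\<Sum>i<m. h (a' i) (b' i))"
    if eq: "(\<Sum>i<n. pure2 scale (a i) (b i)) = (\<Sum>i<m. pure2 scale (a' i) (b' i))"
    for n m :: nat and a b a' b'
  proof (rule U.dual_separates)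
    fix f assume "f \<in> dual_space s'"
    then interpret f: Vector_Spaces.linear s' "(*)" f by (simp add: dual_space_def)
    have bil: "bilinear_form scale (\<lambda>x y. f (h x y))"
      using assms(2,3) unfolding bilinear_form_alt Vector_Spaces.linear_iff
      by (simp add: f.add f.scale)
    have *: "(\<Sum>i<k. pure2 scale (u i) (v i)) (\<lambda>x y. f (h x y)) = f (\<Sum>i<k. h (u i) (v i))"
      for k :: nat and u v
      using bil by (simp add: sum_fun_apply pure2_def f.sum)
    show "f (\<Sum>i<n. h (a i) (b i)) = f (\<Sum>i<m. h (a' i) (b' i))"
      using * eq by metis
  qed
  define H where "H t = (SOME u. \<exists>(n::nat) a b. t = (\<Sum>i<n. pure2 scale (a i) (b i)) \<and>
    u = (\<Sum>i<n. h (a i) (b i)))" for t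
  have "H (\<Sum>i<n. pure2 scale (a i) (b i)) = (\<Sum>i<n. h (a i) (b i))" for n :: nat and a b
    unfolding H_def proof (rule some_equality)
    fix u assume "\<exists>(m::nat) a' b'. (\<Sum>i<n. pure2 scale (a i) (b i)) =
      (\<Sum>i<m. pure2 scale (a' i) (b' i)) \<and> u = (\<Sum>i<m. h (a' i) (b' i))"
    then obtain m :: nat and a' b' where
      "(\<Sum>i<n. pure2 scale (a i) (b i)) = (\<Sum>i<m. pure2 scale (a' i) (b' i))"
      and u: "u = (\<Sum>i<m. h (a' i) (b' i))" by blast
    from wd[OF this(1)] show "u = (\<Sum>i<n. h (a i) (b i))" by (simp only: u)
  qed blast
  then show ?thesis by blast
qed

lemma tmap2_sum:
  assumes "Vector_Spaces.linear scale scale T" "Vector_Spaces.linear scale scale S"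
  shows "tmap2 scale T S (\<Sum>i<n. pure2 scale (a i) (b i)) =
    (\<Sum>i<(n::nat). pure2 scale (T (a i)) (S (b i)))"
proof -
  have "bilinear_form scale (\<lambda>x y. \<beta> (T x) (S y))" if "bilinear_form scale \<beta>" for \<beta>
    using assms that unfolding bilinear_form_alt Vector_Spaces.linear_iff by simp
  then show ?thesis
    by (auto simp: tmap2_def pure2_def sum_fun_apply fun_eq_iff)
qed

end

context fd_space_on
begin

lemma from_bidual:
  assumes "V = UNIV"
    and add: "\<And>f g. \<lbrakk>f \<in> dual_space scale; g \<in> dual_space scale\<rbrakk> \<Longrightarrow> \<Phi> (f + g) = \<Phi> f + \<Phi> g"
    and scl: "\<And>c f. f \<in> dual_space scale \<Longrightarrow> \<Phi> (fun_scale c f) = c * \<Phi> f"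
    and f: "f \<in> dual_space scale"
  shows "f (from_bidual scale \<Phi>) = \<Phi> f"
proof -
  obtain B0 where "finite B0" "span B0 = UNIV"
    using fin_dim assms(1) by blast
  then obtain B where B: "finite B" "independent B" "span B = UNIV"
    by (metis basis_exists finite_subset span_mono span_span subset_UNIV subset_antisym)
  let ?e = "\<lambda>b x. representation B x b"
  have dual_iff: "g \<in> dual_space scale \<longleftrightarrow>
      (\<forall>x y. g (x + y) = g x + g y) \<and> (\<forall>c x. g (scale c x) = c * g x)" for g
    using vector_space_axioms vector_space_field
    unfolding dual_space_def Vector_Spaces.linear_iff by blast
  have e: "?e b \<in> dual_space scale" for b
    unfolding dual_iff using B by (simp add: representation_add representation_scale)
  have sum: "(\<Sum>b\<in>I. fun_scale (c b) (?e b)) \<in> dual_space scale \<and>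
      \<Phi> (\<Sum>b\<in>I. fun_scale (c b) (?e b)) = (\<Sum>b\<in>I. c b * \<Phi> (?e b))" if "finite I" for I c
    using that
  proof (induction I)
    case empty
    have "\<Phi> (fun_scale 0 f) = 0 * \<Phi> f" using f by (rule scl)
    moreover have "fun_scale 0 f = 0" by (auto simp: fun_scale_def)
    ultimately show ?case by (simp add: dual_iff zero_fun_def)
  next
    case (insert b I)
    let ?g = "fun_scale (c b) (?e b)" and ?S = "\<Sum>b\<in>I. fun_scale (c b) (?e b)"
    have g: "?g \<in> dual_space scale"
      using e[of b] unfolding dual_iff by (simp add: fun_scale_def algebra_simps)
    have S: "?S \<in> dual_space scale" and IH: "\<Phi> ?S = (\<Sum>b\<in>I. c b * \<Phi> (?e b))"
      using insert.IH by auto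
    have "?g + ?S \<in> dual_space scale"
      using g S unfolding dual_iff by (simp add: algebra_simps)
    moreover have "\<Phi> (?g + ?S) = c b * \<Phi> (?e b) + (\<Sum>b\<in>I. c b * \<Phi> (?e b))"
      unfolding add[OF g S] scl[OF e] IH ..
    ultimately show ?case
      unfolding sum.insert[OF insert.hyps] by blast
  qed
  have val: "g (\<Sum>b\<in>B. scale (c b) b) = (\<Sum>b\<in>B. c b * g b)" if "g \<in> dual_space scale" for g c
  proof -
    interpret g: Vector_Spaces.linear scale "(*)" g using that by (simp add: dual_space_def)
    show ?thesis by (simp add: g.sum g.scale)
  qed
  have expand: "x = (\<Sum>b\<in>B. scale (?e b x) b)" for x
    using B by (simp add: sum_representation_eq)
  define y where "y = (\<Sum>b\<in>B. scale (\<Phi> (?e b)) b)"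
  have y: "g y = \<Phi> g" if g: "g \<in> dual_space scale" for g
  proof -
    have "g = (\<Sum>b\<in>B. fun_scale (g b) (?e b))"
    proof
      fix x
      show "g x = (\<Sum>b\<in>B. fun_scale (g b) (?e b)) x"
        using val[OF g, of "\<lambda>b. ?e b x"] expand[of x]
        by (simp add: sum_fun_apply fun_scale_def mult.commute)
    qed
    then have "\<Phi> g = (\<Sum>b\<in>B. g b * \<Phi> (?e b))"
      using sum[OF B(1), of g] by simp
    then show ?thesis
      using val[OF g] by (simp add: y_def mult.commute)
  qed
  have "from_bidual scale \<Phi> = y"
    unfolding from_bidual_def by (rule the_equality) (use y dual_separates in auto)
  then show ?thesis using y f by simp
qed

end

context bilinear_op_on
begin

lemma prod_sums:
  fixes n :: nat
  assumes "V = UNIV" "r = (\<Sum>i<n. pure2 scale (a i) (b i))"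
  shows "prod_12_13 scale prd r = (\<Sum>i<n. \<Sum>j<n. pure3 scale (prd (a i) (a j)) (b i) (b j))"
    and "prod_12_23 scale prd r = (\<Sum>i<n. \<Sum>j<n. pure3 scale (a i) (prd (b i) (a j)) (b j))"
    and "prod_13_23 scale prd r = (\<Sum>i<n. \<Sum>j<n. pure3 scale (a i) (a j) (prd (b i) (b j)))"
proof -
  note lin = add_left add_right scale_left scale_right
  have r: "r \<beta> = (\<Sum>i<n. \<beta> (a i) (b i))" if "bilinear_form scale \<beta>" for \<beta>
    using that by (simp add: assms(2) sum_fun_apply pure2_def)
  note bil = bilinear_form_alt trilinear_form_alt
  have inner: "bilinear_form scale (\<lambda>c d. \<theta> (prd x c) y d)"
      "bilinear_form scale (\<lambda>c d. \<theta> x (prd y c) d)"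
      "bilinear_form scale (\<lambda>c d. \<theta> x c (prd y d))"
    if "trilinear_form scale \<theta>" for \<theta> x y
    using that lin assms(1) unfolding bil by simp_all
  have outer: "bilinear_form scale (\<lambda>x y. \<Sum>i<n. \<theta> (prd x (a i)) y (b i))"
      "bilinear_form scale (\<lambda>x y. \<Sum>i<n. \<theta> x (prd y (a i)) (b i))"
      "bilinear_form scale (\<lambda>x y. \<Sum>i<n. \<theta> x (a i) (prd y (b i)))"
    if "trilinear_form scale \<theta>" for \<theta>
    using that lin assms(1) unfolding bil by (simp_all add: sum.distrib sum_distrib_left)
  show "prod_12_13 scale prd r = (\<Sum>i<n. \<Sum>j<n. pure3 scale (prd (a i) (a j)) (b i) (b j))"
    by (rule ext) (auto simp: prod_12_13_def pure3_def sum_fun_apply r inner outer)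
  show "prod_12_23 scale prd r = (\<Sum>i<n. \<Sum>j<n. pure3 scale (a i) (prd (b i) (a j)) (b j))"
    by (rule ext) (auto simp: prod_12_23_def pure3_def sum_fun_apply r inner outer)
  show "prod_13_23 scale prd r = (\<Sum>i<n. \<Sum>j<n. pure3 scale (a i) (a j) (prd (b i) (b j)))"
    by (rule ext) (auto simp: prod_13_23_def pure3_def sum_fun_apply r inner outer)
qed

end

end

theory Submission
  imports Defs
begin

text \<open>
  Write \<open>P = ad(1)\<close> and regard the tensor \<open>r = \<Sum>\<^sub>i a\<^sub>i \<otimes> b\<^sub>i\<close> as the operator
  \<open>R : A\<^sup>* \<rightarrow> A\<close>, \<open>R(f) = \<Sum>\<^sub>i f(a\<^sub>i) b\<^sub>i\<close>. Antisymmetry of \<open>r\<close> says that \<open>R\<close> is skew for the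
  pairing of \<open>A\<close> with \<open>A\<^sup>*\<close>, the two Yang--Baxter equations say that \<open>R\<close> turns the products
  dual to \<open>\<Delta>\<close> and \<open>\<delta>\<close> into those of \<open>A\<close> (\<open>R_mul\<close>, \<open>R_br\<close>), and the two conditions on \<open>P\<close> and
  \<open>Q = -P\<close>, which coincide, say that \<open>R\<close> intertwines \<open>-P\<^sup>*\<close> with \<open>P\<close> (\<open>R_ad_one\<close>).

  The algebra \<open>A\<close> acts on \<open>A\<^sup>*\<close>, and the semidirect product, in which \<open>A\<^sup>*\<close> multiplies to zero, is
  a Frobenius Jacobi algebra with unit \<open>(1, 0)\<close> for the canonical pairing (\<open>frobenius_semidirect\<close>).
  As \<open>R\<close> is skew and respects both products, the shear \<open>(x, f) \<mapsto> (x + R(f), f)\<close> is an isometric isomorphism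
  from \<open>A \<bowtie> A\<^sup>*\<close> onto this semidirect product, so \<open>A \<bowtie> A\<^sup>*\<close> is a Frobenius Jacobi algebra as well
  (\<open>frobenius_bowtie\<close>). This is the Manin triple picture: the double is the semidirect product,
  split along \<open>A\<close> and the isotropic graph of \<open>R\<close>. The derivation of the double is \<open>ad(1, 0)\<close>
  by \<open>R_ad_one\<close> (\<open>bowtie_ad_one\<close>), so its relative Poisson structure is the one that every Jacobi algebra carries.

  Moreover, \<open>A\<^sup>*\<close> with the dual products is a subalgebra of \<open>A \<bowtie> A\<^sup>*\<close>. A tensor in
  \<open>A \<otimes> A \<otimes> A\<close> is determined by its values on the forms \<open>f(x) g(y) h(z)\<close>
  (\<open>functional3_zero_on_pure\<close>), and on such forms coassociativity, the co-Jacobi identity and the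
  co-Leibniz rule become associativity, the Jacobi identity and the Leibniz rule of that subalgebra
  (\<open>coalgebra\<close>). What remains, the compatibility of the coproducts with the products and with \<open>P\<close>,
  is a comparison of operators applied to \<open>r\<close>, which agree modulo the invariance
  \<open>(P \<otimes> id + id \<otimes> P) r = 0\<close> (\<open>bialgebra\<close>).
\<close>

section \<open>Tensors as functionals on multilinear forms\<close>

text \<open>
  The tensors of the given encoding, seen abstractly: linear on multilinear forms and extended by
  \<open>0\<close>. These conditions pass through sums, permutations of legs and coproducts without a choice of
  presentation by pure tensors, which is what makes them convenient for comparing tensors.
\<close>

definition functional2 :: "('k::field \<Rightarrow> 'a::ab_group_add \<Rightarrow> 'a) \<Rightarrow> ('a, 'k) tensor2 \<Rightarrow> bool" where
  "functional2 s t \<longleftrightarrow> (\<forall>\<beta>. \<not> bilinear_form s \<beta> \<longrightarrow> t \<beta> = 0) \<and>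
    (\<forall>\<beta> \<gamma>. bilinear_form s \<beta> \<longrightarrow> bilinear_form s \<gamma> \<longrightarrow>
      t (\<lambda>x y. \<beta> x y + \<gamma> x y) = t \<beta> + t \<gamma>) \<and>
    (\<forall>c \<beta>. bilinear_form s \<beta> \<longrightarrow> t (\<lambda>x y. c * \<beta> x y) = c * t \<beta>)"

definition functional3 :: "('k::field \<Rightarrow> 'a::ab_group_add \<Rightarrow> 'a) \<Rightarrow> ('a, 'k) tensor3 \<Rightarrow> bool" where
  "functional3 s t \<longleftrightarrow> (\<forall>\<theta>. \<not> trilinear_form s \<theta> \<longrightarrow> t \<theta> = 0) \<and>
    (\<forall>\<theta> \<eta>. trilinear_form s \<theta> \<longrightarrow> trilinear_form s \<eta> \<longrightarrow>
      t (\<lambda>x y z. \<theta> x y z + \<eta> x y z) = t \<theta> + t \<eta>) \<and>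
    (\<forall>c \<theta>. trilinear_form s \<theta> \<longrightarrow> t (\<lambda>x y z. c * \<theta> x y z) = c * t \<theta>)"

definition coproduct :: "('k::field \<Rightarrow> 'a::ab_group_add \<Rightarrow> 'a) \<Rightarrow> ('a \<Rightarrow> ('a, 'k) tensor2) \<Rightarrow> bool" where
  "coproduct s D \<longleftrightarrow> Vector_Spaces.linear s fun_scale D \<and> (\<forall>x. functional2 s (D x))"

context vector_space
begin

lemma endo_linearI:
  assumes "\<And>x y. T (x + y) = T x + T y" "\<And>c x. T (scale c x) = scale c (T x)"
  shows "Vector_Spaces.linear scale scale T"
  using assms vector_space_axioms unfolding Vector_Spaces.linear_iff by blast

lemma dual_space_iff:
  "f \<in> dual_space scale \<longleftrightarrow>
    (\<forall>x y. f (x + y) = f x + f y) \<and> (\<forall>c x. f (scale c x) = c * f x)"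
  using vector_space_axioms vector_space_field
  unfolding dual_space_def Vector_Spaces.linear_iff by blast

lemma dual_space_diff: "f \<in> dual_space scale \<Longrightarrow> f (x - y) = f x - f y"
  unfolding dual_space_iff by (metis add_diff_cancel_right' diff_add_cancel)

lemma dual_space_minus: "f \<in> dual_space scale \<Longrightarrow> f (- x) = - f x"
  by (metis dual_space_diff diff_0 diff_self)

lemma dual_space_zero: "f \<in> dual_space scale \<Longrightarrow> f 0 = 0"
  by (metis dual_space_diff diff_self)

lemma dual_space_sum:
  "f \<in> dual_space scale \<Longrightarrow> f (\<Sum>i\<in>I. u i) = (\<Sum>i\<in>I. f (u i))"
  by (induction I rule: infinite_finite_induct) (auto simp: dual_space_zero dual_space_iff)

lemma functional3_add: "functional3 scale t \<Longrightarrow> functional3 scale u \<Longrightarrow> functional3 scale (t + u)"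
  by (auto simp: functional3_def algebra_simps)

lemma functional3_diff: "functional3 scale t \<Longrightarrow> functional3 scale u \<Longrightarrow> functional3 scale (t - u)"
  by (auto simp: functional3_def algebra_simps)

lemma trilinear_cycle: "trilinear_form scale (\<lambda>x y z. \<theta> y z x) \<longleftrightarrow> trilinear_form scale \<theta>"
  unfolding trilinear_form_def by blast

lemma trilinear_flip12: "trilinear_form scale (\<lambda>x y z. \<theta> y x z) \<longleftrightarrow> trilinear_form scale \<theta>"
  unfolding trilinear_form_def by blast

lemma functional3_cycle: "functional3 scale t \<Longrightarrow> functional3 scale (cycle3 t)"
  unfolding functional3_def cycle3_def
proof (intro conjI allI impI, goal_cases)
  case (1 \<theta>) then show ?case using trilinear_cycle[of \<theta>] by blast
next
  case (2 \<theta> \<eta>) then show ?case using trilinear_cycle[of \<theta>] trilinear_cycle[of \<eta>] by blast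
next
  case (3 c \<theta>) then show ?case using trilinear_cycle[of \<theta>] by blast
qed

lemma functional3_flip12: "functional3 scale t \<Longrightarrow> functional3 scale (flip12 t)"
  unfolding functional3_def flip12_def
proof (intro conjI allI impI, goal_cases)
  case (1 \<theta>) then show ?case using trilinear_flip12[of \<theta>] by blast
next
  case (2 \<theta> \<eta>) then show ?case using trilinear_flip12[of \<theta>] trilinear_flip12[of \<eta>] by blast
next
  case (3 c \<theta>) then show ?case using trilinear_flip12[of \<theta>] by blast
qed

lemma functional3_tmap3:
  assumes "functional3 scale t" "Vector_Spaces.linear scale scale T"
  shows "functional3 scale (tmap3 scale T id id t)"
proof -
  have "trilinear_form scale (\<lambda>x y z. \<theta> (T x) y z)" if "trilinear_form scale \<theta>" for \<theta>
    using that assms(2) unfolding trilinear_form_alt Vector_Spaces.linear_iff by simp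
  moreover have "trilinear_form scale (\<lambda>x y z. \<theta> x y z + \<eta> x y z)"
    if "trilinear_form scale \<theta>" "trilinear_form scale \<eta>" for \<theta> \<eta>
    using that unfolding trilinear_form_alt by (simp add: algebra_simps)
  moreover have "trilinear_form scale (\<lambda>x y z. c * \<theta> x y z)"
    if "trilinear_form scale \<theta>" for \<theta> c
    using that unfolding trilinear_form_alt by (simp add: algebra_simps)
  ultimately show ?thesis
    using assms(1) by (simp add: functional3_def tmap3_def)
qed

lemma functional3_sum:
  assumes "functional3 scale t" "finite I" "\<And>i. i \<in> I \<Longrightarrow> trilinear_form scale (\<theta> i)"
  shows "trilinear_form scale (\<lambda>x y z. \<Sum>i\<in>I. c i * \<theta> i x y z) \<and>
    t (\<lambda>x y z. \<Sum>i\<in>I. c i * \<theta> i x y z) = (\<Sum>i\<in>I. c i * t (\<theta> i))"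
  using assms(2,3)
proof (induction I)
  case empty
  have 0: "trilinear_form scale (\<lambda>x y z. 0)"
    unfolding trilinear_form_alt by simp
  have "t (\<lambda>x y z. 0 * 0) = 0 * t (\<lambda>x y z. 0)"
    using assms(1) 0 unfolding functional3_def by (elim conjE allE) (erule mp)
  then show ?case using 0 by simp
next
  case (insert i I)
  let ?S = "\<lambda>x y z. \<Sum>i\<in>I. c i * \<theta> i x y z"
  have S: "trilinear_form scale ?S" and IH: "t ?S = (\<Sum>i\<in>I. c i * t (\<theta> i))"
    using insert by auto
  have i: "trilinear_form scale (\<theta> i)" using insert by auto
  then have ci: "trilinear_form scale (\<lambda>x y z. c i * \<theta> i x y z)"
    unfolding trilinear_form_alt by (simp add: algebra_simps)
  have "trilinear_form scale (\<lambda>x y z. c i * \<theta> i x y z + ?S x y z)"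
    using ci S unfolding trilinear_form_alt by (simp add: algebra_simps)
  moreover have "t (\<lambda>x y z. c i * \<theta> i x y z + ?S x y z) = t (\<lambda>x y z. c i * \<theta> i x y z) + t ?S"
    using assms(1) ci S unfolding functional3_def by blast
  moreover have "t (\<lambda>x y z. c i * \<theta> i x y z) = c i * t (\<theta> i)"
    using assms(1) i unfolding functional3_def by blast
  ultimately show ?case
    using insert.hyps IH by simp
qed

text \<open>A basis together with its coordinate functions, packaged without reference to independence.\<close>

lemma finite_coordinates:
  assumes "\<exists>B. finite B \<and> span B = UNIV"
  obtains B e where "finite B" "\<And>b. e b \<in> dual_space scale"
    "\<And>x. x = (\<Sum>b\<in>B. scale (e b x) b)"
proof -
  obtain B0 where "finite B0" "span B0 = UNIV"
    using assms by blast
  then obtain B where B: "finite B" "independent B" "span B = UNIV"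
    by (metis basis_exists finite_subset span_mono span_span subset_UNIV subset_antisym)
  show thesis
  proof (rule that[of B "\<lambda>b x. representation B x b"])
    show "(\<lambda>x. representation B x b) \<in> dual_space scale" for b
      unfolding dual_space_iff using B by (simp add: representation_add representation_scale)
  qed (use B in \<open>simp_all add: sum_representation_eq\<close>)
qed

text \<open>
  Expanding each argument in coordinates writes a trilinear form as a finite combination of products
  of three linear functionals, so a functional that kills the products kills everything. This
  reduces identities of coproducts to identities of the dual products.
\<close>

lemma functional3_zero_on_pure:
  assumes fin: "\<exists>B. finite B \<and> span B = UNIV" and t: "functional3 scale t"
    and pure: "\<And>f g h. \<lbrakk>f \<in> dual_space scale; g \<in> dual_space scale; h \<in> dual_space scale\<rbrakk> \<Longrightarrow>
      t (\<lambda>x y z. f x * (g y * h z)) = 0"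
  shows "t = 0"
proof
  fix \<theta>
  show "t \<theta> = 0 \<theta>"
  proof (cases "trilinear_form scale \<theta>")
    case False
    then show ?thesis using t by (simp add: functional3_def)
  next
    case \<theta>: True
    obtain B e where B: "finite B" and e: "\<And>b. e b \<in> dual_space scale"
      and ex: "\<And>x. x = (\<Sum>b\<in>B. scale (e b x) b)"
      using finite_coordinates[OF fin] by blast
    let ?c = "\<lambda>(b, c, d). \<theta> b c d" and ?p = "\<lambda>(b, c, d). \<lambda>x y z. e b x * (e c y * e d z)"
    have tri: "trilinear_form scale (?p i)" for i
      using e unfolding trilinear_form_alt dual_space_iff
      by (auto simp: algebra_simps split: prod.splits)
    have 1: "(\<lambda>u. \<theta> u y z) \<in> dual_space scale" "(\<lambda>u. \<theta> x u z) \<in> dual_space scale"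
      "(\<lambda>u. \<theta> x y u) \<in> dual_space scale" for x y z
      using \<theta> unfolding trilinear_form_alt dual_space_iff by auto
    have x: "\<theta> x y z = (\<Sum>b\<in>B. e b x * \<theta> b y z)" for x y z
      using dual_space_sum[OF 1(1)[of y z], of "\<lambda>b. scale (e b x) b" B] ex[of x] \<theta>
      by (simp add: trilinear_form_alt)
    have y: "\<theta> x y z = (\<Sum>b\<in>B. e b y * \<theta> x b z)" for x y z
      using dual_space_sum[OF 1(2)[of x z], of "\<lambda>b. scale (e b y) b" B] ex[of y] \<theta>
      by (simp add: trilinear_form_alt)
    have z: "\<theta> x y z = (\<Sum>b\<in>B. e b z * \<theta> x y b)" for x y z
      using dual_space_sum[OF 1(3)[of x y], of "\<lambda>b. scale (e b z) b" B] ex[of z] \<theta>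
      by (simp add: trilinear_form_alt)
    have "\<theta> x y z = (\<Sum>i\<in>B \<times> B \<times> B. ?c i * ?p i x y z)" for x y z
    proof -
      have "\<theta> x y z = (\<Sum>b\<in>B. e b x * (\<Sum>c\<in>B. e c y * (\<Sum>d\<in>B. e d z * \<theta> b c d)))"
        by (subst x, subst y, subst z) (rule refl)
      also have "\<dots> = (\<Sum>i\<in>B \<times> B \<times> B. ?c i * ?p i x y z)"
        by (simp add: sum_distrib_left sum.cartesian_product case_prod_unfold algebra_simps)
      finally show ?thesis .
    qed
    then have "\<theta> = (\<lambda>x y z. \<Sum>i\<in>B \<times> B \<times> B. ?c i * ?p i x y z)"
      by blast
    then have "t \<theta> = t (\<lambda>x y z. \<Sum>i\<in>B \<times> B \<times> B. ?c i * ?p i x y z)"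
      by (rule arg_cong)
    also have "\<dots> = (\<Sum>i\<in>B \<times> B \<times> B. ?c i * t (?p i))"
      using functional3_sum[of t "B \<times> B \<times> B" ?p ?c] t tri B by blast
    also have "\<dots> = 0"
      using pure e by (auto intro!: sum.neutral)
    finally show ?thesis by simp
  qed
qed

lemma coproduct_apply:
  assumes "coproduct scale D"
  shows "D (x + y) \<beta> = D x \<beta> + D y \<beta>" "D (scale c x) \<beta> = c * D x \<beta>"
  using assms unfolding coproduct_def Vector_Spaces.linear_iff
  by (simp_all add: fun_scale_def)

lemma coproduct_bilinear:
  assumes "coproduct scale D" "trilinear_form scale \<theta>"
  shows "bilinear_form scale (\<lambda>x y. D y (\<lambda>u v. \<theta> x u v))"
    "bilinear_form scale (\<lambda>x y. D x (\<lambda>u v. \<theta> u v y))"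
proof -
  have b: "bilinear_form scale (\<lambda>u v. \<theta> x u v)" "bilinear_form scale (\<lambda>u v. \<theta> u v x)" for x
    using assms(2) unfolding bilinear_form_alt trilinear_form_alt by simp_all
  have add: "D y (\<lambda>u v. \<beta> u v + \<gamma> u v) = D y \<beta> + D y \<gamma>"
    if "bilinear_form scale \<beta>" "bilinear_form scale \<gamma>" for y \<beta> \<gamma>
    using that assms(1) unfolding coproduct_def functional2_def by blast
  have scl: "D y (\<lambda>u v. c * \<beta> u v) = c * D y \<beta>" if "bilinear_form scale \<beta>" for y c \<beta>
    using that assms(1) unfolding coproduct_def functional2_def by blast
  have \<theta>: "\<theta> (x + y) = (\<lambda>u v. \<theta> x u v + \<theta> y u v)" "\<theta> (scale c x) = (\<lambda>u v. c * \<theta> x u v)" for x y c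
    using assms(2) unfolding trilinear_form_alt by (simp_all add: fun_eq_iff)
  show "bilinear_form scale (\<lambda>x y. D y (\<lambda>u v. \<theta> x u v))"
    using b unfolding bilinear_form_alt[of "\<lambda>x y. D y (\<lambda>u v. \<theta> x u v)"]
    by (simp add: coproduct_apply[OF assms(1)] \<theta> add scl)
  show "bilinear_form scale (\<lambda>x y. D x (\<lambda>u v. \<theta> u v y))"
    using assms(2) unfolding bilinear_form_alt[of "\<lambda>x y. D x (\<lambda>u v. \<theta> u v y)"] trilinear_form_alt
    by (simp add: coproduct_apply[OF assms(1)] add b scl)
qed

lemma functional3_coproduct:
  assumes "coproduct scale D" "functional2 scale t"
  shows "functional3 scale (id_tensor scale D t)" "functional3 scale (tensor_id scale D t)"
proof -
  have b: "bilinear_form scale (\<lambda>u v. \<theta> x u v)" "bilinear_form scale (\<lambda>u v. \<theta> u v x)"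
    if "trilinear_form scale \<theta>" for \<theta> x
    using that unfolding bilinear_form_alt trilinear_form_alt by simp_all
  have t: "bilinear_form scale \<beta> \<Longrightarrow> bilinear_form scale \<gamma> \<Longrightarrow>
      t (\<lambda>u v. \<beta> u v + \<gamma> u v) = t \<beta> + t \<gamma>"
    "bilinear_form scale \<beta> \<Longrightarrow> t (\<lambda>u v. c * \<beta> u v) = c * t \<beta>" for \<beta> \<gamma> c
    using assms(2) unfolding functional2_def by blast+
  have D: "bilinear_form scale \<beta> \<Longrightarrow> bilinear_form scale \<gamma> \<Longrightarrow>
      D y (\<lambda>u v. \<beta> u v + \<gamma> u v) = D y \<beta> + D y \<gamma>"
    "bilinear_form scale \<beta> \<Longrightarrow> D y (\<lambda>u v. c * \<beta> u v) = c * D y \<beta>" for y \<beta> \<gamma> c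
    using assms(1) unfolding functional2_def coproduct_def by blast+
  have tri: "trilinear_form scale (\<lambda>x y z. \<theta> x y z + \<eta> x y z)"
    if "trilinear_form scale \<theta>" "trilinear_form scale \<eta>" for \<theta> \<eta>
    using that unfolding trilinear_form_alt by (simp add: algebra_simps)
  have tri': "trilinear_form scale (\<lambda>x y z. c * \<theta> x y z)"
    if "trilinear_form scale \<theta>" for \<theta> c
    using that unfolding trilinear_form_alt by (simp add: algebra_simps)
  note cb = coproduct_bilinear[OF assms(1)]
  show "functional3 scale (id_tensor scale D t)" "functional3 scale (tensor_id scale D t)"
    unfolding functional3_def id_tensor_def tensor_id_def
    by (simp_all add: tri tri' b D t cb)
qed

text \<open>
  Iterated coproducts are dual to iterated products; the maps \<open>E\<close> and \<open>D\<close> may be different, as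
  \<open>\<Delta>\<close> and \<open>\<delta>\<close> occur mixed in the co-Leibniz rule.
\<close>

lemma tensor_pure:
  assumes "coproduct scale D" and dual: "f \<in> dual_space scale" "g \<in> dual_space scale" "h \<in> dual_space scale"
  shows "id_tensor scale D (E x) (\<lambda>x y z. f x * (g y * h z)) = dual_op E f (dual_op D g h) x"
    and "tensor_id scale D (E x) (\<lambda>x y z. f x * (g y * h z)) = dual_op E (dual_op D f g) h x"
proof -
  have tri: "trilinear_form scale (\<lambda>x y z. f x * (g y * h z))"
    using dual unfolding trilinear_form_alt dual_space_iff by (simp add: algebra_simps)
  have bil: "bilinear_form scale (\<lambda>x y. f x * g y)" "bilinear_form scale (\<lambda>x y. g x * h y)"
    using dual unfolding bilinear_form_alt dual_space_iff by (simp_all add: algebra_simps)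
  have scl: "D y (\<lambda>u v. c * \<beta> u v) = c * D y \<beta>" if "bilinear_form scale \<beta>" for y c \<beta>
    using that assms(1) unfolding coproduct_def functional2_def by blast
  show "id_tensor scale D (E x) (\<lambda>x y z. f x * (g y * h z)) = dual_op E f (dual_op D g h) x"
    using tri by (simp add: id_tensor_def dual_op_def scl bil)
  have "D u (\<lambda>x y. f x * (g y * c)) = D u (\<lambda>x y. f x * g y) * c" for u c
    using scl[OF bil(1), of u c] by (simp add: mult_ac)
  then show "tensor_id scale D (E x) (\<lambda>x y z. f x * (g y * h z)) = dual_op E (dual_op D f g) h x"
    using tri by (simp add: tensor_id_def dual_op_def)
qed

lemma dual_op_closed:
  assumes "coproduct scale D"
  shows "dual_op D f g \<in> dual_space scale"
  by (simp add: dual_space_iff dual_op_def coproduct_apply[OF assms])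

lemma sum_pure2_apply:
  "(\<Sum>i<(n::nat). pure2 scale (a i) (b i)) \<beta> =
    (if bilinear_form scale \<beta> then \<Sum>i<n. \<beta> (a i) (b i) else 0)"
  by (simp add: sum_fun_apply pure2_def)

lemma tensors2_sumI: "(\<Sum>i<(n::nat). pure2 scale (a i) (b i)) \<in> tensors2 scale"
  unfolding tensors2_def mem_Collect_eq by (intro exI conjI TrueI) (rule refl)

lemma tensors2_functional2: "t \<in> tensors2 scale \<Longrightarrow> functional2 scale t"
proof -
  assume "t \<in> tensors2 scale"
  then obtain n :: nat and a b where t: "t = (\<Sum>i<n. pure2 scale (a i) (b i))"
    unfolding tensors2_def by blast
  have "bilinear_form scale (\<lambda>x y. \<beta> x y + \<gamma> x y)"
    if "bilinear_form scale \<beta>" "bilinear_form scale \<gamma>" for \<beta> \<gamma>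
    using that unfolding bilinear_form_alt by (simp add: algebra_simps)
  moreover have "bilinear_form scale (\<lambda>x y. c * \<beta> x y)"
    if "bilinear_form scale \<beta>" for \<beta> c
    using that unfolding bilinear_form_alt by (simp add: algebra_simps)
  ultimately show ?thesis
    unfolding functional2_def t sum_pure2_apply by (simp add: sum.distrib sum_distrib_left)
qed

lemma tensors2_add:
  assumes "t \<in> tensors2 scale" "u \<in> tensors2 scale"
  shows "t + u \<in> tensors2 scale"
proof -
  obtain n :: nat and a b where t: "t = (\<Sum>i<n. pure2 scale (a i) (b i))"
    using assms unfolding tensors2_def by blast
  obtain m :: nat and c d where u: "u = (\<Sum>i<m. pure2 scale (c i) (d i))"
    using assms unfolding tensors2_def by blast
  let ?a = "\<lambda>i. if i < n then a i else c (i - n)" and ?b = "\<lambda>i. if i < n then b i else d (i - n)"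
  have "(\<Sum>i<k + n. pure2 scale (?a i) (?b i)) = t + (\<Sum>i<k. pure2 scale (c i) (d i))" for k
    by (induction k) (simp_all add: t add.assoc)
  from this[of m] have "t + u = (\<Sum>i<m + n. pure2 scale (?a i) (?b i))"
    unfolding u by simp
  then show ?thesis
    by (simp only: tensors2_sumI)
qed

lemma tensors2_minus:
  assumes "t \<in> tensors2 scale"
  shows "- t \<in> tensors2 scale"
proof -
  obtain n :: nat and a b where t: "t = (\<Sum>i<n. pure2 scale (a i) (b i))"
    using assms unfolding tensors2_def by blast
  have m: "\<beta> (- x) y = - \<beta> x y" if "bilinear_form scale \<beta>" for \<beta> x y
    using dual_space_minus[of "\<lambda>x. \<beta> x y"] that unfolding bilinear_form_def dual_space_def by simp
  have "- t = (\<Sum>i<n. pure2 scale (- a i) (b i))"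
    by (rule ext) (simp add: t sum_pure2_apply m sum_negf)
  then show ?thesis by (simp only: tensors2_sumI)
qed

lemma tensors2_tmap2:
  assumes "t \<in> tensors2 scale" "Vector_Spaces.linear scale scale T" "Vector_Spaces.linear scale scale S"
  shows "tmap2 scale T S t \<in> tensors2 scale"
proof -
  obtain n :: nat and a b where t: "t = (\<Sum>i<n. pure2 scale (a i) (b i))"
    using assms unfolding tensors2_def by blast
  show ?thesis unfolding t tmap2_sum[OF assms(2,3)] by (rule tensors2_sumI)
qed

end

section \<open>Jacobi algebras\<close>

context fd_space_on
begin

lemma carrier_add: "x \<in> V \<Longrightarrow> y \<in> V \<Longrightarrow> x + y \<in> V"
  using fin_dim span_add by blast

lemma carrier_scale: "x \<in> V \<Longrightarrow> scale c x \<in> V"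
  using fin_dim span_scale by blast

lemma carrier_zero: "0 \<in> V"
  using fin_dim span_zero by blast

end

lemma (in lie_algebra_on) br_swap:
  assumes "x \<in> V" "y \<in> V"
  shows "br x y = - br y x"
proof -
  have "br (x + y) (x + y) = 0"
    using assms by (intro br_self carrier_add)
  then have "br y x + br x y = 0"
    using br_self[OF assms(1)] br_self[OF assms(2)] assms
    by (simp add: add_left add_right carrier_add)
  then show ?thesis by (simp add: eq_neg_iff_add_eq_0 add.commute)
qed

text \<open>
  The Leibniz rule of a Jacobi algebra differs from that of a Poisson algebra by a multiple of
  \<open>[1, z]\<close>. For \<open>z = 1\<close> this correction vanishes, which makes \<open>ad(1)\<close> a derivation of the product.
\<close>

lemma (in jacobi_algebra_on) relative_poisson_ad_one:
  assumes P: "\<And>x. x \<in> V \<Longrightarrow> P x = br one x"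
  shows "relative_poisson_algebra_on scale V mul br P"
proof -
  note [simp] = one_closed lie.closed mult.closed mult.carrier_add mult.carrier_scale
  have d: "br one (br x y) = br (br one x) y + br x (br one y)" if "x \<in> V" "y \<in> V" for x y
  proof -
    have "br one (br x y) = - br x (br y one) - br y (br one x)"
      using lie.jacobi[of one x y] that
      by (simp add: add_eq_0_iff2 algebra_simps)
    moreover have "br x (br y one) = - br x (br one y)"
      using lie.br_swap[of y one] lie.scale_right[of x "br one y" "-1"] that by simp
    moreover have "br y (br one x) = - br (br one x) y"
      using lie.br_swap[of y "br one x"] that by simp
    ultimately show ?thesis by simp
  qed
  have z: "br one one = 0" by (simp add: lie.br_self)
  have mz: "mul x 0 = 0" if "x \<in> V" for x
    using mult.scale_right[of x one 0] that by simp
  show ?thesis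
  proof (unfold_locales, goal_cases)
    case (4 x y) then show ?case by (simp add: P jacobi_leibniz z mz)
  qed (simp_all add: P lie.add_right lie.scale_right d jacobi_leibniz)
qed

text \<open>
  Transport of structure: the algebraic laws follow by injectivity of \<open>\<phi>\<close>, nondegeneracy of the form
  by surjectivity.
\<close>

lemma frobenius_jacobi_transport:
  assumes "frobenius_jacobi_algebra_on s W mul br one B" and "fd_space_on s' V"
    and inj: "inj_on \<phi> V" and img: "\<phi> ` V = W"
    and add: "\<And>x y. x \<in> V \<Longrightarrow> y \<in> V \<Longrightarrow> \<phi> (x + y) = \<phi> x + \<phi> y"
    and scl: "\<And>c x. x \<in> V \<Longrightarrow> \<phi> (s' c x) = s c (\<phi> x)"
    and mc: "\<And>x y. x \<in> V \<Longrightarrow> y \<in> V \<Longrightarrow> mul' x y \<in> V"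
    and mh: "\<And>x y. x \<in> V \<Longrightarrow> y \<in> V \<Longrightarrow> \<phi> (mul' x y) = mul (\<phi> x) (\<phi> y)"
    and bc: "\<And>x y. x \<in> V \<Longrightarrow> y \<in> V \<Longrightarrow> br' x y \<in> V"
    and bh: "\<And>x y. x \<in> V \<Longrightarrow> y \<in> V \<Longrightarrow> \<phi> (br' x y) = br (\<phi> x) (\<phi> y)"
    and oc: "one' \<in> V" and oh: "\<phi> one' = one"
    and form: "\<And>x y. x \<in> V \<Longrightarrow> y \<in> V \<Longrightarrow> B' x y = B (\<phi> x) (\<phi> y)"
  shows "frobenius_jacobi_algebra_on s' V mul' br' one' B'"
proof -
  interpret F: frobenius_jacobi_algebra_on s W mul br one B by fact
  interpret V: fd_space_on s' V by fact
  have W: "x \<in> V \<Longrightarrow> \<phi> x \<in> W" for x using img by blast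
  have eqI: "x = y" if "x \<in> V" "y \<in> V" "\<phi> x = \<phi> y" for x y
    using inj that by (simp add: inj_on_def)
  have z: "\<phi> 0 = 0" using add[of 0 0] V.carrier_zero by simp
  note c [simp] = V.carrier_add V.carrier_scale V.carrier_zero mc bc oc W add scl mh bh oh z form
  have nd: "x = 0" if "x \<in> V" "\<And>y. y \<in> V \<Longrightarrow> B (\<phi> x) (\<phi> y) = 0" for x
    using that by (intro eqI) (auto simp: img[symmetric] intro!: F.form_nondegenerate)
  show ?thesis
    by (unfold_locales; (rule nd; (simp; fail) | (rule V.fin_dim) | (intro eqI)?; simp add: F.mult.add_left
      F.mult.add_right F.mult.scale_left F.mult.scale_right F.lie.add_left F.lie.add_right
      F.lie.scale_left F.lie.scale_right F.mult.mul_commute F.mult.mul_assoc F.lie.br_self F.lie.jacobi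
      F.one_left F.jacobi_leibniz F.form_add F.form_scale F.form_sym F.form_mul F.form_br))
qed

section \<open>The semidirect product with the dual space\<close>

fun semidirect_mul :: "('a \<Rightarrow> 'a \<Rightarrow> 'a) \<Rightarrow>
    'a \<times> ('a \<Rightarrow> 'k::plus) \<Rightarrow> 'a \<times> ('a \<Rightarrow> 'k) \<Rightarrow> 'a \<times> ('a \<Rightarrow> 'k)" where
  "semidirect_mul mul (x, f) (y, g) = (mul x y, \<lambda>v. g (mul x v) + f (mul y v))"

fun semidirect_br :: "('a \<Rightarrow> 'a \<Rightarrow> 'a) \<Rightarrow>
    'a \<times> ('a \<Rightarrow> 'k::minus) \<Rightarrow> 'a \<times> ('a \<Rightarrow> 'k) \<Rightarrow> 'a \<times> ('a \<Rightarrow> 'k)" where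
  "semidirect_br br (x, f) (y, g) = (br x y, \<lambda>v. f (br y v) - g (br x v))"

text \<open>The basis vectors of \<open>A\<close> and the coordinate functions span \<open>A \<oplus> A\<^sup>*\<close>.\<close>

lemma (in vector_space) fd_space_bowtie:
  assumes "\<exists>B. finite B \<and> span B = UNIV"
  shows "fd_space_on (bowtie_scale scale) (bowtie_space scale)"
proof -
  interpret W: vector_space "bowtie_scale scale"
    by unfold_locales (auto simp: bowtie_scale_def fun_scale_def fun_eq_iff algebra_simps)
  obtain B e where B: "finite B" and e: "\<And>b. e b \<in> dual_space scale"
    and ex: "\<And>x. x = (\<Sum>b\<in>B. scale (e b x) b)"
    using finite_coordinates[OF assms] by blast
  let ?G = "(\<lambda>b. (b, 0)) ` B \<union> (\<lambda>b. (0, e b)) ` B"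
  have "W.subspace (bowtie_space scale)"
    unfolding W.subspace_def bowtie_space_def bowtie_scale_def fun_scale_def
    by (auto simp: dual_space_iff zero_prod_def algebra_simps)
  moreover have "?G \<subseteq> bowtie_space scale"
    using e by (auto simp: bowtie_space_def) (simp add: dual_space_iff)
  ultimately have 1: "W.span ?G \<subseteq> bowtie_space scale"
    by (intro W.span_minimal)
  have 2: "bowtie_space scale \<subseteq> W.span ?G"
  proof
    fix u assume u: "u \<in> bowtie_space scale"
    obtain x f where xf: "u = (x, f)" by (cases u)
    with u have f: "f \<in> dual_space scale" by (simp add: bowtie_space_def)
    have fe: "f = (\<Sum>b\<in>B. fun_scale (f b) (e b))"
    proof
      fix y
      have "f y = f (\<Sum>b\<in>B. scale (e b y) b)" by (rule arg_cong[OF ex])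
      also have "\<dots> = (\<Sum>b\<in>B. e b y * f b)"
        using f unfolding dual_space_sum[OF f] by (simp add: dual_space_iff)
      finally show "f y = (\<Sum>b\<in>B. fun_scale (f b) (e b)) y"
        by (simp add: sum_fun_apply fun_scale_def mult.commute)
    qed
    have z: "fun_scale c (0 :: 'b \<Rightarrow> 'a) = 0" for c
      by (simp add: fun_scale_def fun_eq_iff)
    have "u = (\<Sum>b\<in>B. bowtie_scale scale (e b x) (b, 0)) +
        (\<Sum>b\<in>B. bowtie_scale scale (f b) (0, e b))"
      unfolding xf
      by (rule prod_eqI) (simp_all add: fst_sum snd_sum bowtie_scale_def z ex[symmetric] fe[symmetric])
    also have "\<dots> \<in> W.span ?G"
      by (intro W.span_add W.span_sum W.span_scale W.span_base) auto
    finally show "u \<in> W.span ?G" .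
  qed
  show ?thesis
    by unfold_locales (rule exI[of _ ?G], use 1 2 B in auto)
qed

locale jacobi_algebra = jacobi_algebra_on scale UNIV mul br one
  for scale :: "'k::field \<Rightarrow> 'a::ab_group_add \<Rightarrow> 'a" and mul br one
begin

lemmas bilinear_simps [simp] =
  mult.add_left[OF UNIV_I UNIV_I UNIV_I] mult.add_right[OF UNIV_I UNIV_I UNIV_I]
  mult.scale_left[OF UNIV_I UNIV_I] mult.scale_right[OF UNIV_I UNIV_I]
  lie.add_left[OF UNIV_I UNIV_I UNIV_I] lie.add_right[OF UNIV_I UNIV_I UNIV_I]
  lie.scale_left[OF UNIV_I UNIV_I] lie.scale_right[OF UNIV_I UNIV_I]

lemmas mul_commute = mult.mul_commute[OF UNIV_I UNIV_I]
lemmas mul_assoc = mult.mul_assoc[OF UNIV_I UNIV_I UNIV_I]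
lemmas br_swap = lie.br_swap[OF UNIV_I UNIV_I]
lemmas leibniz = jacobi_leibniz[OF UNIV_I UNIV_I UNIV_I]

lemma mul_left_commute: "mul x (mul y z) = mul y (mul x z)"
  by (metis mul_assoc mul_commute)

lemma one_mul [simp]: "mul one x = x"
  by (simp add: one_left)

lemma jacobi_ad: "br (br x y) z = br x (br y z) - br y (br x z)"
proof -
  have m: "br x (- y) = - br x y" for x y
    using lie.scale_right[of x y "-1"] by simp
  have "br x (br y z) + br y (br z x) + br z (br x y) = 0"
    by (rule lie.jacobi) auto
  moreover have "br y (br z x) = - br y (br x z)" using br_swap[of z x] m by simp
  moreover have "br z (br x y) = - br (br x y) z" by (rule br_swap)
  ultimately show ?thesis by (simp add: algebra_simps add_eq_0_iff)
qed

lemma bilinear_zero_minus_diff [simp]: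
  "mul 0 x = 0" "mul x 0 = 0" "br 0 x = 0" "br x 0 = 0"
  "mul (- x) y = - mul x y" "mul x (- y) = - mul x y" "br (- x) y = - br x y" "br x (- y) = - br x y"
  "mul (x - y) z = mul x z - mul y z" "mul x (y - z) = mul x y - mul x z"
  "br (x - y) z = br x z - br y z" "br x (y - z) = br x y - br x z"
proof -
  show m: "mul (- x) y = - mul x y" "mul x (- y) = - mul x y"
    "br (- x) y = - br x y" "br x (- y) = - br x y" for x y
    using mult.scale_left[of x y "-1"] mult.scale_right[of x y "-1"]
      lie.scale_left[of x y "-1"] lie.scale_right[of x y "-1"] by simp_all
  show "mul 0 x = 0" "mul x 0 = 0" "br 0 x = 0" "br x 0 = 0"
    using mult.scale_left[of x x 0] mult.scale_right[of x x 0]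
      lie.scale_left[of x x 0] lie.scale_right[of x x 0] by simp_all
  show "mul (x - y) z = mul x z - mul y z" "mul x (y - z) = mul x y - mul x z"
    "br (x - y) z = br x z - br y z" "br x (y - z) = br x y - br x z"
    using bilinear_simps(1)[of x "- y" z] bilinear_simps(2)[of x y "- z"]
      bilinear_simps(5)[of x "- y" z] bilinear_simps(6)[of x y "- z"]
    by (simp_all add: m)
qed

lemma br_self [simp]: "br x x = 0"
  by (rule lie.br_self) simp

text \<open>
  The Leibniz rule in the first argument. Together with the rule in the second argument it moves
  every bracket inside all products, which serves as a normal form below.
\<close>

lemma br_mul_left: "br (mul x y) z = mul x (br y z) + mul y (br x z) - mul (mul x y) (br one z)"
  using br_swap[of z x] br_swap[of z y] br_swap[of "mul x y" z]
  by (simp add: leibniz algebra_simps mul_assoc mul_commute mul_left_commute)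

lemma fin_dim_UNIV: "\<exists>B. finite B \<and> mult.span B = UNIV"
  by (rule mult.fin_dim)

text \<open>
  The functionals \<open>f\<close>, \<open>g\<close>, \<open>h\<close> enter each law linearly, and their coefficients are identities of
  \<open>A\<close>. In the Leibniz rule for \<open>[(z, h), (x, f) (y, g)]\<close> the coefficient of \<open>h\<close> is the identity
  \<open>[x y, v] = [x, y v] + [y, x v] - [1, x y v]\<close>, special to Jacobi algebras: it says that \<open>-ad(1)\<close>
  dually represents \<open>A\<close>.
\<close>

lemma frobenius_semidirect:
  "frobenius_jacobi_algebra_on (bowtie_scale scale) (bowtie_space scale)
    (semidirect_mul mul) (semidirect_br br) (one, 0) bowtie_form"
proof -
  interpret W: fd_space_on "bowtie_scale scale" "bowtie_space scale"
    by (rule mult.fd_space_bowtie[OF fin_dim_UNIV])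
  have dual: "f (u + v) = f u + f v" "f (u - v) = f u - f v" "f (- u) = - f u" "f 0 = 0"
    "f (scale c u) = c * f u" if "f \<in> dual_space scale" for f u v c
    using that mult.dual_space_diff[OF that] mult.dual_space_minus[OF that] mult.dual_space_zero[OF that]
    by (simp_all add: mult.dual_space_iff)
  have closed: "semidirect_mul mul u v \<in> bowtie_space scale" "semidirect_br br u v \<in> bowtie_space scale"
    if "u \<in> bowtie_space scale" "v \<in> bowtie_space scale" for u v
    using that unfolding bowtie_space_def
    by (cases u; cases v; simp add: mult.dual_space_iff algebra_simps)+
  have leib_pair: "semidirect_br br (z, h) (semidirect_mul mul (x, f) (y, g)) =
      semidirect_mul mul (semidirect_br br (z, h) (x, f)) (y, g) +
      semidirect_mul mul (x, f) (semidirect_br br (z, h) (y, g)) +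
      semidirect_mul mul (semidirect_mul mul (x, f) (y, g)) (semidirect_br br (one, 0) (z, h))"
    if "f \<in> dual_space scale" "g \<in> dual_space scale" "h \<in> dual_space scale" for x y z f g h
    using that br_swap[of y x]
    by (simp add: fun_eq_iff dual br_mul_left leibniz algebra_simps mul_commute mul_left_commute mul_assoc)
  have leib: "semidirect_br br w (semidirect_mul mul u v) = semidirect_mul mul (semidirect_br br w u) v +
      semidirect_mul mul u (semidirect_br br w v) +
      semidirect_mul mul (semidirect_mul mul u v) (semidirect_br br (one, 0) w)"
    if "u \<in> bowtie_space scale" "v \<in> bowtie_space scale" "w \<in> bowtie_space scale" for u v w
    using that unfolding bowtie_space_def
    by (cases u; cases v; cases w; simp only: leib_pair mem_Times_iff fst_conv snd_conv)
  have form_br: "bowtie_form (semidirect_br br u v) w = bowtie_form u (semidirect_br br v w)"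
    if "u \<in> bowtie_space scale" "v \<in> bowtie_space scale" "w \<in> bowtie_space scale" for u v w
    using that unfolding bowtie_space_def
    using br_swap[of "fst u" "fst v"] br_swap[of "fst u" "fst w"]
    by (cases u; cases v; cases w; simp add: dual)
  have jac: "semidirect_br br u (semidirect_br br v w) + semidirect_br br v (semidirect_br br w u) +
      semidirect_br br w (semidirect_br br u v) = 0"
    if "u \<in> bowtie_space scale" "v \<in> bowtie_space scale" "w \<in> bowtie_space scale" for u v w
    using that unfolding bowtie_space_def
    by (cases u; cases v; cases w; simp add: fun_eq_iff dual lie.jacobi jacobi_ad zero_prod_def)
  have nd: "u = 0" if u: "u \<in> bowtie_space scale"
    and 0: "\<And>v. v \<in> bowtie_space scale \<Longrightarrow> bowtie_form u v = 0" for u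
  proof -
    obtain x f where xf: "u = (x, f)" by (cases u)
    have z: "0 \<in> dual_space scale" by (simp add: mult.dual_space_iff)
    have "f y = 0" for y
      using 0[of "(y, 0)"] z by (simp add: xf bowtie_space_def)
    moreover have "g x = 0" if "g \<in> dual_space scale" for g
      using 0[of "(0, g)"] u that mult.dual_space_zero[of f] by (auto simp: xf bowtie_space_def)
    then have "x = 0" by (intro mult.dual_separates) (simp add: dual(4))
    ultimately show ?thesis by (simp add: xf zero_prod_def fun_eq_iff)
  qed
  show ?thesis
    by (unfold_locales; ((simp add: closed jac leib form_br; fail) | (rule nd; (simp; fail)) |
      (simp_all add: split_paired_all bowtie_space_def bowtie_scale_def fun_scale_def fun_eq_iff
        dual zero_prod_def; (simp add: mult.dual_space_iff distrib_left right_diff_distrib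
          mul_assoc mul_commute mul_left_commute add_ac)?)))
qed

end

section \<open>Antisymmetric solutions as operators\<close>

text \<open>
  The summands of \<open>r\<close> are fixed as parameters so that the operator \<open>R\<close> has a formula that makes
  sense for arbitrary functions \<open>f\<close>; it is then linear without restriction to \<open>A\<^sup>*\<close>.
\<close>

locale triangular_jacobi_algebra = jacobi_algebra scale mul br one
  for scale :: "'k::field \<Rightarrow> 'a::ab_group_add \<Rightarrow> 'a" and mul br one +
  fixes n :: nat and a b :: "nat \<Rightarrow> 'a" and r :: "('a, 'k) tensor2"
  defines r_def: "r \<equiv> \<Sum>i<n. pure2 scale (a i) (b i)"
  assumes antisym: "antisymmetric_tensor r"
    and rpybe: "rpybe_solution scale mul br (br one) (\<lambda>x. - br one x) r"
begin

definition R :: "('a \<Rightarrow> 'k) \<Rightarrow> 'a" where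
  "R f = (\<Sum>i<n. scale (f (a i)) (b i))"

abbreviation "\<Delta> \<equiv> cobound_\<Delta> scale mul r"
abbreviation "\<delta> \<equiv> cobound_\<delta> scale br r"

lemma linear_ops:
  "Vector_Spaces.linear scale scale (mul x)" "Vector_Spaces.linear scale scale (br x)"
  "Vector_Spaces.linear scale scale (\<lambda>y. - br x y)" "Vector_Spaces.linear scale scale id"
  by (rule mult.endo_linearI; simp)+

lemma r_apply: "bilinear_form scale \<beta> \<Longrightarrow> r \<beta> = (\<Sum>i<n. \<beta> (a i) (b i))"
  by (simp add: r_def mult.sum_pure2_apply)

lemma antisym_sum:
  assumes "bilinear_form scale \<beta>"
  shows "(\<Sum>i<n. \<beta> (b i) (a i)) = - (\<Sum>i<n. \<beta> (a i) (b i))"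
proof -
  have "bilinear_form scale (\<lambda>x y. \<beta> y x)"
    using assms unfolding bilinear_form_def by blast
  moreover have "r \<beta> + flip2 r \<beta> = 0"
    using antisym unfolding antisymmetric_tensor_def by (metis plus_fun_apply zero_fun_apply)
  ultimately show ?thesis
    using r_apply[OF assms] r_apply[of "\<lambda>x y. \<beta> y x"]
    by (simp add: flip2_def eq_neg_iff_add_eq_0 add.commute)
qed

lemma pairing_bilinear:
  "f \<in> dual_space scale \<Longrightarrow> g \<in> dual_space scale \<Longrightarrow> bilinear_form scale (\<lambda>x y. f x * g y)"
  by (simp add: mult.bilinear_form_alt mult.dual_space_iff algebra_simps)

lemma R_pairing: "g \<in> dual_space scale \<Longrightarrow> g (R f) = (\<Sum>i<n. f (a i) * g (b i))"
  by (simp add: R_def mult.dual_space_sum) (simp add: mult.dual_space_iff)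

lemma R_skew:
  assumes "f \<in> dual_space scale" "g \<in> dual_space scale"
  shows "f (R g) = - g (R f)"
  using antisym_sum[OF pairing_bilinear[OF assms]] assms by (simp add: R_pairing mult.commute)

lemma R_flip:
  assumes "f \<in> dual_space scale"
  shows "(\<Sum>i<n. scale (f (b i)) (a i)) = - R f"
proof (rule mult.dual_separates)
  fix g assume g: "g \<in> dual_space scale"
  have "g (\<Sum>i<n. scale (f (b i)) (a i)) = (\<Sum>i<n. f (b i) * g (a i))"
    using g by (simp add: mult.dual_space_sum) (simp add: mult.dual_space_iff)
  also have "\<dots> = - g (R f)"
    using antisym_sum[OF pairing_bilinear[OF assms g]] g by (simp add: R_pairing)
  finally show "g (\<Sum>i<n. scale (f (b i)) (a i)) = g (- R f)"
    using g by (simp add: mult.dual_space_minus)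
qed

lemma R_linear: "R (\<lambda>x. f x + g x) = R f + R g" "R (\<lambda>x. f x - g x) = R f - R g"
  "R (\<lambda>x. c * f x) = scale c (R f)" "R (\<lambda>x. - f x) = - R f" "R (\<lambda>x. 0) = 0"
  by (simp_all add: R_def sum.distrib sum_subtractf sum_negf mult.scale_sum_right
    mult.scale_left_distrib mult.scale_left_diff_distrib)

lemma dual_comp:
  assumes "f \<in> dual_space scale"
  shows "(\<lambda>v. f (mul x v)) \<in> dual_space scale" "(\<lambda>v. f (mul v x)) \<in> dual_space scale"
   "(\<lambda>v. f (br x v)) \<in> dual_space scale" "(\<lambda>v. f (br v x)) \<in> dual_space scale"
  using assms by (simp_all add: mult.dual_space_iff)

lemma tmap2_r:
  assumes "bilinear_form scale \<beta>" "Vector_Spaces.linear scale scale T" "Vector_Spaces.linear scale scale S"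
  shows "tmap2 scale T S r \<beta> = (\<Sum>i<n. \<beta> (T (a i)) (S (b i)))"
  using assms by (simp add: r_def mult.tmap2_sum mult.sum_pure2_apply)

lemma \<Delta>_apply:
  "bilinear_form scale \<beta> \<Longrightarrow> \<Delta> x \<beta> = (\<Sum>i<n. \<beta> (a i) (mul x (b i)) - \<beta> (mul x (a i)) (b i))"
  by (simp add: cobound_\<Delta>_def tmap2_r linear_ops sum_subtractf)

lemma \<delta>_apply:
  "bilinear_form scale \<beta> \<Longrightarrow> \<delta> x \<beta> = (\<Sum>i<n. \<beta> (br x (a i)) (b i) + \<beta> (a i) (br x (b i)))"
  by (simp add: cobound_\<delta>_def tmap2_r linear_ops sum.distrib)

text \<open>
  The second summand of \<open>\<Delta>\<close> pairs \<open>g\<close> with the second leg of \<open>r\<close>, which is \<open>R\<close> applied to \<open>f\<close>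
  precomposed with a multiplication; skewness of \<open>R\<close> turns it into \<open>f\<close> at a multiple of \<open>R(g)\<close>.
\<close>

lemma dual_mul:
  assumes "f \<in> dual_space scale" "g \<in> dual_space scale"
  shows "dual_op \<Delta> f g = (\<lambda>x. g (mul (R f) x) + f (mul (R g) x))"
proof
  fix x
  have "g (mul x (R f)) = (\<Sum>i<n. f (a i) * g (mul x (b i)))"
    by (rule R_pairing[OF dual_comp(1)]) fact
  moreover have "f (mul x (R g)) = - (\<Sum>i<n. f (mul x (a i)) * g (b i))"
    using R_skew[OF dual_comp(1)[OF assms(1)] assms(2), of x]
      R_pairing[OF assms(2), of "\<lambda>v. f (mul x v)"] by simp
  ultimately show "dual_op \<Delta> f g x = g (mul (R f) x) + f (mul (R g) x)"
    by (simp add: dual_op_def \<Delta>_apply pairing_bilinear assms sum_subtractf mul_commute[of x])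
qed

lemma dual_br:
  assumes "f \<in> dual_space scale" "g \<in> dual_space scale"
  shows "dual_op \<delta> f g = (\<lambda>x. f (br (R g) x) - g (br (R f) x))"
proof
  fix x
  have "g (br x (R f)) = (\<Sum>i<n. f (a i) * g (br x (b i)))"
    by (rule R_pairing[OF dual_comp(3)]) fact
  moreover have "f (br x (R g)) = - (\<Sum>i<n. f (br x (a i)) * g (b i))"
    using R_skew[OF dual_comp(3)[OF assms(1)] assms(2), of x]
      R_pairing[OF assms(2), of "\<lambda>v. f (br x v)"] by simp
  ultimately show "dual_op \<delta> f g x = f (br (R g) x) - g (br (R f) x)"
    using assms by (simp add: dual_op_def \<delta>_apply pairing_bilinear sum.distrib
      br_swap[of "R _" x] mult.dual_space_minus)
qed

lemma trilinear_pure: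
  "f \<in> dual_space scale \<Longrightarrow> g \<in> dual_space scale \<Longrightarrow> h \<in> dual_space scale \<Longrightarrow>
    trilinear_form scale (\<lambda>x y z. f x * (g y * h z))"
  by (simp add: mult.trilinear_form_alt mult.dual_space_iff algebra_simps)

text \<open>
  The three terms of the Yang--Baxter equations on product forms. The sign in the first one comes
  from contracting the second leg of \<open>r\<close> rather than the first.
\<close>

lemma prod_r_pure:
  assumes d: "f \<in> dual_space scale" "g \<in> dual_space scale" "h \<in> dual_space scale"
    and prd: "bilinear_op_on scale UNIV prd"
  shows "prod_12_13 scale prd r (\<lambda>x y z. f x * (g y * h z)) = - h (R (\<lambda>v. f (prd (R g) v)))"
    and "prod_12_23 scale prd r (\<lambda>x y z. f x * (g y * h z)) = h (R (\<lambda>v. g (prd (R f) v)))"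
    and "prod_13_23 scale prd r (\<lambda>x y z. f x * (g y * h z)) = h (prd (R f) (R g))"
proof -
  interpret p: bilinear_op_on scale UNIV prd by fact
  have dc: "(\<lambda>v. f (prd x v)) \<in> dual_space scale" "(\<lambda>v. f (prd v x)) \<in> dual_space scale"
    if "f \<in> dual_space scale" for f x
    using that by (simp_all add: mult.dual_space_iff p.add_left p.add_right p.scale_left p.scale_right)
  have prd_minus: "prd (- u) v = - prd u v" for u v
    using p.scale_left[of u v "-1"] by simp
  note ps = p.prod_sums[OF refl r_def[THEN meta_eq_to_obj_eq]]
  note tri = trilinear_pure[OF d]
  have "prod_12_13 scale prd r (\<lambda>x y z. f x * (g y * h z)) =
      (\<Sum>i<n. \<Sum>j<n. f (prd (a i) (a j)) * (g (b i) * h (b j)))"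
    by (simp add: ps(1) sum_fun_apply pure3_def tri)
  also have "\<dots> = (\<Sum>j<n. f (prd (\<Sum>i<n. scale (g (b i)) (a i)) (a j)) * h (b j))"
    by (subst sum.swap) (simp add: mult.dual_space_sum[OF dc(2)[OF d(1)]],
      simp add: p.scale_left d(1)[unfolded mult.dual_space_iff] sum_distrib_left sum_distrib_right mult_ac)
  also have "\<dots> = (\<Sum>j<n. - f (prd (R g) (a j)) * h (b j))"
    by (simp add: R_flip d prd_minus mult.dual_space_minus[OF d(1)])
  also have "\<dots> = - h (R (\<lambda>v. f (prd (R g) v)))"
    by (simp add: R_pairing[OF d(3)] sum_negf)
  finally show "prod_12_13 scale prd r (\<lambda>x y z. f x * (g y * h z)) = - h (R (\<lambda>v. f (prd (R g) v)))" .
  have "prod_12_23 scale prd r (\<lambda>x y z. f x * (g y * h z)) =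
      (\<Sum>i<n. \<Sum>j<n. f (a i) * (g (prd (b i) (a j)) * h (b j)))"
    by (simp add: ps(2) sum_fun_apply pure3_def tri)
  also have "\<dots> = (\<Sum>j<n. g (prd (R f) (a j)) * h (b j))"
    by (subst sum.swap) (simp add: R_pairing[OF dc(2)[OF d(2)]] sum_distrib_left sum_distrib_right mult_ac)
  finally show "prod_12_23 scale prd r (\<lambda>x y z. f x * (g y * h z)) = h (R (\<lambda>v. g (prd (R f) v)))"
    by (simp add: R_pairing[OF d(3)])
  have "prod_13_23 scale prd r (\<lambda>x y z. f x * (g y * h z)) =
      (\<Sum>i<n. \<Sum>j<n. f (a i) * (g (a j) * h (prd (b i) (b j))))"
    by (simp add: ps(3) sum_fun_apply pure3_def tri)
  also have "\<dots> = h (prd (R f) (R g))"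
    by (simp add: R_pairing[OF dc(1)[OF d(3)]] R_pairing[OF dc(2)[OF d(3)]] sum_distrib_left mult_ac)
      (subst sum.swap, rule refl)
  finally show "prod_13_23 scale prd r (\<lambda>x y z. f x * (g y * h z)) = h (prd (R f) (R g))" .
qed

text \<open>
  By \<open>dual_mul\<close> and \<open>dual_br\<close> the right hand sides of the following two lemmas are \<open>R\<close> of the dual
  products of \<open>f\<close> and \<open>g\<close>.
\<close>

lemma R_mul:
  assumes "f \<in> dual_space scale" "g \<in> dual_space scale"
  shows "mul (R f) (R g) = R (\<lambda>v. g (mul (R f) v) + f (mul (R g) v))"
proof (rule mult.dual_separates)
  fix h assume h: "h \<in> dual_space scale"
  have "prod_12_13 scale mul r - prod_12_23 scale mul r + prod_13_23 scale mul r = 0"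
    using rpybe by (simp add: rpybe_solution_def)
  from fun_cong[OF this, of "\<lambda>x y z. f x * (g y * h z)"]
  show "h (mul (R f) (R g)) = h (R (\<lambda>v. g (mul (R f) v) + f (mul (R g) v)))"
    using h by (simp add: prod_r_pure[OF assms h mult.bilinear_op_on_axioms] R_linear
      algebra_simps) (simp add: mult.dual_space_iff)
qed

lemma R_br:
  assumes "f \<in> dual_space scale" "g \<in> dual_space scale"
  shows "br (R f) (R g) = R (\<lambda>v. f (br (R g) v) - g (br (R f) v))"
proof (rule mult.dual_separates)
  fix h assume h: "h \<in> dual_space scale"
  have "prod_12_13 scale br r + prod_12_23 scale br r + prod_13_23 scale br r = 0"
    using rpybe by (simp add: rpybe_solution_def)
  from fun_cong[OF this, of "\<lambda>x y z. f x * (g y * h z)"]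
  show "h (br (R f) (R g)) = h (R (\<lambda>v. f (br (R g) v) - g (br (R f) v)))"
    using h by (simp add: prod_r_pure[OF assms h lie.bilinear_op_on_axioms] R_linear
      mult.dual_space_diff algebra_simps)
qed

lemma ad_one_invariant:
  assumes "bilinear_form scale \<beta>"
  shows "(\<Sum>i<n. \<beta> (br one (a i)) (b i) + \<beta> (a i) (br one (b i))) = 0"
proof -
  have "tmap2 scale (br one) id r - tmap2 scale id (\<lambda>x. - br one x) r = 0"
    using rpybe by (simp add: rpybe_solution_def)
  from fun_cong[OF this, of \<beta>] show ?thesis
    using mult.dual_space_minus[of "\<beta> x" for x] assms
    by (simp add: tmap2_r linear_ops sum.distrib sum_negf bilinear_form_def dual_space_def)
qed

lemma R_ad_one:
  assumes "f \<in> dual_space scale"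
  shows "R (\<lambda>v. f (br one v)) = - br one (R f)"
proof (rule mult.dual_separates)
  fix g assume g: "g \<in> dual_space scale"
  have "g (br one (R f)) = (\<Sum>i<n. f (a i) * g (br one (b i)))"
    by (rule R_pairing[OF dual_comp(3)]) fact
  moreover have "g (R (\<lambda>v. f (br one v))) = (\<Sum>i<n. f (br one (a i)) * g (b i))"
    by (rule R_pairing) fact
  ultimately show "g (R (\<lambda>v. f (br one v))) = g (- br one (R f))"
    using ad_one_invariant[OF pairing_bilinear[OF assms g]] g
    by (simp add: sum.distrib mult.dual_space_minus eq_neg_iff_add_eq_0)
qed

end

section \<open>The induced algebra as a semidirect product\<close>

context triangular_jacobi_algebra
begin

lemma from_bidual_eq:
  assumes "\<And>g. g \<in> dual_space scale \<Longrightarrow> g z = \<Phi> g"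
  shows "from_bidual scale \<Phi> = z"
  unfolding from_bidual_def
  by (rule the_equality) (use assms in \<open>auto intro!: mult.dual_separates\<close>)

text \<open>
  Skewness of \<open>R\<close> makes the coadjoint action of \<open>A\<^sup>*\<close> on \<open>A\<close> explicit. It measures the failure of
  \<open>R\<close> to commute with the action of \<open>A\<close>, which is why the shear removes it.
\<close>

lemma coadjoint_mul:
  assumes f: "f \<in> dual_space scale"
  shows "coadjoint scale (dual_op \<Delta>) f y = R (\<lambda>v. f (mul y v)) - mul y (R f)"
  unfolding coadjoint_def
proof (rule from_bidual_eq)
  fix g assume g: "g \<in> dual_space scale"
  show "g (R (\<lambda>v. f (mul y v)) - mul y (R f)) = dual_rep (dual_op \<Delta>) f (\<lambda>g. g y) g"
    using R_skew[OF dual_comp(1)[OF f] g, of y]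
    by (simp add: dual_rep_def dual_mul f g mult.dual_space_diff mul_commute[of _ y])
qed

lemma coadjoint_br:
  assumes f: "f \<in> dual_space scale"
  shows "coadjoint scale (dual_op \<delta>) f y = - R (\<lambda>v. f (br y v)) - br y (R f)"
  unfolding coadjoint_def
proof (rule from_bidual_eq)
  fix g assume g: "g \<in> dual_space scale"
  show "g (- R (\<lambda>v. f (br y v)) - br y (R f)) = dual_rep (dual_op \<delta>) f (\<lambda>g. g y) g"
    using R_skew[OF dual_comp(3)[OF f] g, of y]
    by (simp add: dual_rep_def dual_br f g mult.dual_space_diff mult.dual_space_minus br_swap[of "R _" y])
qed

definition shear :: "'a \<times> ('a \<Rightarrow> 'k) \<Rightarrow> 'a \<times> ('a \<Rightarrow> 'k)" where
  "shear u = (fst u + R (snd u), snd u)"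

lemma bowtie_mul_eq:
  assumes "f \<in> dual_space scale" "g \<in> dual_space scale"
  shows "bowtie_mul scale mul \<Delta> (x, f) (y, g) =
    (mul x y - (R (\<lambda>v. f (mul y v)) - mul y (R f)) - (R (\<lambda>v. g (mul x v)) - mul x (R g)),
     \<lambda>v. g (mul (R f) v) + f (mul (R g) v) + g (mul x v) + f (mul y v))"
  using assms by (simp add: coadjoint_mul dual_mul dual_rep_def fun_eq_iff)

lemma bowtie_br_eq:
  assumes "f \<in> dual_space scale" "g \<in> dual_space scale"
  shows "bowtie_br scale br \<delta> (x, f) (y, g) =
    (br x y + (- R (\<lambda>v. f (br y v)) - br y (R f)) - (- R (\<lambda>v. g (br x v)) - br x (R g)),
     \<lambda>v. f (br (R g) v) - g (br (R f) v) - g (br x v) + f (br y v))"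
  using assms by (simp add: coadjoint_br dual_br dual_rep_def fun_eq_iff)

lemma shear_bowtie_mul:
  assumes "f \<in> dual_space scale" "g \<in> dual_space scale"
  shows "shear (bowtie_mul scale mul \<Delta> (x, f) (y, g)) = semidirect_mul mul (shear (x, f)) (shear (y, g))"
  using assms R_mul[OF assms] unfolding bowtie_mul_eq[OF assms]
  by (simp add: shear_def R_linear fun_eq_iff mul_commute[of "R f" y])
    (simp add: mult.dual_space_iff algebra_simps)

lemma shear_bowtie_br:
  assumes "f \<in> dual_space scale" "g \<in> dual_space scale"
  shows "shear (bowtie_br scale br \<delta> (x, f) (y, g)) = semidirect_br br (shear (x, f)) (shear (y, g))"
  using assms R_br[OF assms] br_swap[of "R f" y] unfolding bowtie_br_eq[OF assms]
  by (simp add: shear_def R_linear fun_eq_iff)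
    (simp add: mult.dual_space_iff algebra_simps)

text \<open>
  The shear preserves the form because the additional terms \<open>g(R(f))\<close> and \<open>f(R(g))\<close> cancel, and it
  fixes \<open>(1, 0)\<close>, so the unit of the double is that of \<open>A\<close>.
\<close>

lemma frobenius_bowtie:
  "frobenius_jacobi_algebra_on (bowtie_scale scale) (bowtie_space scale)
    (bowtie_mul scale mul \<Delta>) (bowtie_br scale br \<delta>) (one, 0) bowtie_form"
proof (rule frobenius_jacobi_transport[OF frobenius_semidirect, where \<phi> = shear])
  let ?V = "bowtie_space scale"
  show "fd_space_on (bowtie_scale scale) ?V"
    by (rule mult.fd_space_bowtie[OF fin_dim_UNIV])
  show "inj_on shear ?V"
    by (auto simp: inj_on_def shear_def)
  have "u = shear (fst u - R (snd u), snd u)" for u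
    by (simp add: shear_def)
  then have "u \<in> shear ` ?V" if "u \<in> ?V" for u
    by (rule image_eqI) (use that in \<open>auto simp: bowtie_space_def\<close>)
  then show "shear ` ?V = ?V"
    by (auto simp: bowtie_space_def shear_def)
  show "shear (u + v) = shear u + shear v" for u v
    by (simp add: shear_def plus_fun_def R_linear)
  show "shear (bowtie_scale scale c u) = bowtie_scale scale c (shear u)" for c u
    by (cases u) (simp add: shear_def bowtie_scale_def fun_scale_def R_linear mult.scale_right_distrib)
  show "(one, 0) \<in> ?V"
    by (simp add: bowtie_space_def mult.dual_space_iff)
  show "shear (one, 0) = (one, 0)"
    by (simp add: shear_def zero_fun_def R_linear)
  show "bowtie_mul scale mul \<Delta> u v \<in> ?V" "bowtie_br scale br \<delta> u v \<in> ?V"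
    "shear (bowtie_mul scale mul \<Delta> u v) = semidirect_mul mul (shear u) (shear v)"
    "shear (bowtie_br scale br \<delta> u v) = semidirect_br br (shear u) (shear v)"
    "bowtie_form u v = bowtie_form (shear u) (shear v)"
    if "u \<in> ?V" "v \<in> ?V" for u v
  proof -
    obtain x f y g where uv: "u = (x, f)" "v = (y, g)" by (metis surj_pair)
    have d: "f \<in> dual_space scale" "g \<in> dual_space scale"
      using that by (simp_all add: uv bowtie_space_def)
    show "shear (bowtie_mul scale mul \<Delta> u v) = semidirect_mul mul (shear u) (shear v)"
      "shear (bowtie_br scale br \<delta> u v) = semidirect_br br (shear u) (shear v)"
      unfolding uv by (rule shear_bowtie_mul[OF d] shear_bowtie_br[OF d])+
    show "bowtie_mul scale mul \<Delta> u v \<in> ?V" "bowtie_br scale br \<delta> u v \<in> ?V"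
      using d by (simp_all add: uv bowtie_mul_eq[OF d] bowtie_br_eq[OF d] bowtie_space_def
        del: bowtie_mul.simps bowtie_br.simps) (simp_all add: mult.dual_space_iff algebra_simps)
    show "bowtie_form u v = bowtie_form (shear u) (shear v)"
      using d R_skew[OF d] by (simp add: uv shear_def) (simp add: mult.dual_space_iff)
  qed
qed

lemma bowtie_ad_one:
  assumes f: "f \<in> dual_space scale"
  shows "bowtie_br scale br \<delta> (one, 0) (x, f) = (br one x, - transpose_map (br one) f)"
proof -
  have 0: "0 \<in> dual_space scale" by (simp add: mult.dual_space_iff)
  have [simp]: "R 0 = 0" by (simp add: zero_fun_def R_linear)
  show ?thesis
    by (simp add: bowtie_br_eq[OF 0 f] R_linear R_ad_one[OF f] transpose_map_def fun_eq_iff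
      mult.dual_space_zero[OF f] del: bowtie_br.simps)
qed

sublocale double: frobenius_jacobi_algebra_on "bowtie_scale scale" "bowtie_space scale"
  "bowtie_mul scale mul \<Delta>" "bowtie_br scale br \<delta>" "(one, 0)" bowtie_form
  by (rule frobenius_bowtie)

lemma relative_poisson_bowtie:
  "relative_poisson_algebra_on (bowtie_scale scale) (bowtie_space scale)
    (bowtie_mul scale mul \<Delta>) (bowtie_br scale br \<delta>)
    (map_prod (br one) (\<lambda>f. - transpose_map (br one) f))"
proof (rule double.relative_poisson_ad_one)
  fix u assume "u \<in> bowtie_space scale"
  then show "map_prod (br one) (\<lambda>f. - transpose_map (br one) f) u = bowtie_br scale br \<delta> (one, 0) u"
    by (cases u) (simp add: bowtie_space_def bowtie_ad_one del: bowtie_br.simps)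
qed

section \<open>The coalgebra\<close>

lemma dual_subalgebra:
  assumes "f \<in> dual_space scale" "g \<in> dual_space scale"
  shows "bowtie_mul scale mul \<Delta> (0, f) (0, g) = (0, dual_op \<Delta> f g)"
    "bowtie_br scale br \<delta> (0, f) (0, g) = (0, dual_op \<delta> f g)"
  using assms
  by (simp_all add: bowtie_mul_eq bowtie_br_eq R_linear mult.dual_space_zero dual_mul dual_br
    del: bowtie_mul.simps bowtie_br.simps)

lemma bilinear_form_simps:
  assumes "bilinear_form scale \<beta>"
  shows "\<beta> (x + y) z = \<beta> x z + \<beta> y z" "\<beta> z (x + y) = \<beta> z x + \<beta> z y"
    "\<beta> (x - y) z = \<beta> x z - \<beta> y z" "\<beta> z (x - y) = \<beta> z x - \<beta> z y"
    "\<beta> (- x) z = - \<beta> x z" "\<beta> z (- x) = - \<beta> z x"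
    "\<beta> (scale c x) z = c * \<beta> x z" "\<beta> z (scale c x) = c * \<beta> z x"
proof -
  have d: "(\<lambda>u. \<beta> u z) \<in> dual_space scale" "(\<lambda>u. \<beta> z u) \<in> dual_space scale" for z
    using assms unfolding bilinear_form_def dual_space_def by auto
  show "\<beta> (x + y) z = \<beta> x z + \<beta> y z" "\<beta> z (x + y) = \<beta> z x + \<beta> z y"
    "\<beta> (scale c x) z = c * \<beta> x z" "\<beta> z (scale c x) = c * \<beta> z x"
    using assms unfolding mult.bilinear_form_alt by simp_all
  show "\<beta> (x - y) z = \<beta> x z - \<beta> y z" "\<beta> (- x) z = - \<beta> x z"
    using mult.dual_space_diff[OF d(1)] mult.dual_space_minus[OF d(1)] by simp_all
  show "\<beta> z (x - y) = \<beta> z x - \<beta> z y" "\<beta> z (- x) = - \<beta> z x"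
    using mult.dual_space_diff[OF d(2)] mult.dual_space_minus[OF d(2)] by simp_all
qed

lemma bilinear_form_comp:
  assumes "bilinear_form scale \<beta>" "Vector_Spaces.linear scale scale T" "Vector_Spaces.linear scale scale S"
  shows "bilinear_form scale (\<lambda>x y. \<beta> (T x) (S y))"
  using assms unfolding mult.bilinear_form_alt Vector_Spaces.linear_iff by simp

lemma cobound_outside:
  "\<not> bilinear_form scale \<beta> \<Longrightarrow> \<Delta> x \<beta> = 0" "\<not> bilinear_form scale \<beta> \<Longrightarrow> \<delta> x \<beta> = 0"
  by (simp_all add: cobound_\<Delta>_def cobound_\<delta>_def tmap2_def)

lemma cobound_in_tensors2: "\<Delta> x \<in> tensors2 scale" "\<delta> x \<in> tensors2 scale"
proof -
  have r: "r \<in> tensors2 scale" unfolding r_def by (rule mult.tensors2_sumI)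
  have t: "tmap2 scale T S r \<in> tensors2 scale"
    if "Vector_Spaces.linear scale scale T" "Vector_Spaces.linear scale scale S" for T S
    by (rule mult.tensors2_tmap2[OF r that])
  show "\<Delta> x \<in> tensors2 scale"
    unfolding cobound_\<Delta>_def
    using mult.tensors2_add[OF t mult.tensors2_minus[OF t], of id "mul x" "mul x" id] linear_ops by simp
  show "\<delta> x \<in> tensors2 scale"
    unfolding cobound_\<delta>_def
    using mult.tensors2_add[OF t t, of "br x" id id "br x"] linear_ops by simp
qed

lemma cobound_linear:
  "Vector_Spaces.linear scale fun_scale \<Delta>" "Vector_Spaces.linear scale fun_scale \<delta>"
proof -
  have "\<Delta> (x + y) \<beta> = \<Delta> x \<beta> + \<Delta> y \<beta>" "\<Delta> (scale c x) \<beta> = c * \<Delta> x \<beta>"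
    "\<delta> (x + y) \<beta> = \<delta> x \<beta> + \<delta> y \<beta>" "\<delta> (scale c x) \<beta> = c * \<delta> x \<beta>" for x y c \<beta>
    by (cases "bilinear_form scale \<beta>"; simp add: cobound_outside \<Delta>_apply \<delta>_apply
      bilinear_form_simps sum.distrib sum_subtractf sum_distrib_left algebra_simps)+
  then show "Vector_Spaces.linear scale fun_scale \<Delta>" "Vector_Spaces.linear scale fun_scale \<delta>"
    unfolding Vector_Spaces.linear_iff fun_scale_def
    using mult.vector_space_axioms mult.fun_scale_vector_space[unfolded fun_scale_def]
    by (auto simp: fun_eq_iff fun_scale_def)
qed

lemma coproducts: "coproduct scale \<Delta>" "coproduct scale \<delta>"
  unfolding coproduct_def
  using cobound_linear cobound_in_tensors2 mult.tensors2_functional2 by blast+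

lemma tmap2_cobound:
  assumes "Vector_Spaces.linear scale scale T" "Vector_Spaces.linear scale scale S"
  shows "tmap2 scale T S (\<Delta> x) \<beta> = (if bilinear_form scale \<beta> then
      \<Sum>i<n. \<beta> (T (a i)) (S (mul x (b i))) - \<beta> (T (mul x (a i))) (S (b i)) else 0)"
    "tmap2 scale T S (\<delta> x) \<beta> = (if bilinear_form scale \<beta> then
      \<Sum>i<n. \<beta> (T (br x (a i))) (S (b i)) + \<beta> (T (a i)) (S (br x (b i))) else 0)"
  by (simp_all add: tmap2_def \<Delta>_apply \<delta>_apply bilinear_form_comp[OF _ assms])

text \<open>
  Since \<open>P\<close> is a derivation, the two sides differ by terms that contain
  \<open>(P \<otimes> id + id \<otimes> P) r\<close> with a further operator applied to one leg. As \<open>Q = -P\<close>, this gives the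
  compatibility of the coproducts both with \<open>Q\<close> and with \<open>P\<close>.
\<close>

lemma cobound_ad_one:
  "\<Delta> (br one x) = tmap2 scale (br one) id (\<Delta> x) + tmap2 scale id (br one) (\<Delta> x)"
  "\<delta> (br one x) = tmap2 scale (br one) id (\<delta> x) + tmap2 scale id (br one) (\<delta> x)"
proof -
  have inv: "(\<Sum>i<n. \<beta> (T (br one (a i))) (S (b i))) = - (\<Sum>i<n. \<beta> (T (a i)) (S (br one (b i))))"
    if "bilinear_form scale \<beta>" "Vector_Spaces.linear scale scale T" "Vector_Spaces.linear scale scale S"
    for \<beta> T S
    using ad_one_invariant[OF bilinear_form_comp[OF that]] by (simp add: sum.distrib eq_neg_iff_add_eq_0)
  show "\<Delta> (br one x) = tmap2 scale (br one) id (\<Delta> x) + tmap2 scale id (br one) (\<Delta> x)"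
  proof
    fix \<beta>
    show "\<Delta> (br one x) \<beta> = (tmap2 scale (br one) id (\<Delta> x) + tmap2 scale id (br one) (\<Delta> x)) \<beta>"
    proof (cases "bilinear_form scale \<beta>")
      case True
      then show ?thesis
        using inv[OF True linear_ops(4) linear_ops(1)[of x]] inv[OF True linear_ops(1)[of x] linear_ops(4)]
        by (simp add: \<Delta>_apply tmap2_cobound linear_ops leibniz bilinear_form_simps sum.distrib sum_subtractf)
    qed (simp add: cobound_outside tmap2_cobound linear_ops)
  qed
  show "\<delta> (br one x) = tmap2 scale (br one) id (\<delta> x) + tmap2 scale id (br one) (\<delta> x)"
  proof
    fix \<beta>
    show "\<delta> (br one x) \<beta> = (tmap2 scale (br one) id (\<delta> x) + tmap2 scale id (br one) (\<delta> x)) \<beta>"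
    proof (cases "bilinear_form scale \<beta>")
      case True
      then show ?thesis
        using inv[OF True linear_ops(4) linear_ops(2)[of x]] inv[OF True linear_ops(2)[of x] linear_ops(4)]
        by (simp add: \<delta>_apply tmap2_cobound linear_ops jacobi_ad bilinear_form_simps sum.distrib sum_subtractf)
    qed (simp add: cobound_outside tmap2_cobound linear_ops)
  qed
qed

lemma tmap2_minus_cobound:
  "tmap2 scale (\<lambda>y. - br one y) id (\<Delta> x) = - tmap2 scale (br one) id (\<Delta> x)"
  "tmap2 scale id (\<lambda>y. - br one y) (\<Delta> x) = - tmap2 scale id (br one) (\<Delta> x)"
  "tmap2 scale (\<lambda>y. - br one y) id (\<delta> x) = - tmap2 scale (br one) id (\<delta> x)"
  "tmap2 scale id (\<lambda>y. - br one y) (\<delta> x) = - tmap2 scale id (br one) (\<delta> x)"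
  by (auto simp: fun_eq_iff tmap2_cobound linear_ops bilinear_form_simps sum.distrib sum_subtractf sum_negf)

lemma tensor3_zero:
  assumes "functional3 scale t"
    and "\<And>f g h. \<lbrakk>f \<in> dual_space scale; g \<in> dual_space scale; h \<in> dual_space scale\<rbrakk> \<Longrightarrow>
      t (\<lambda>x y z. f x * (g y * h z)) = 0"
  shows "t = 0"
  using mult.functional3_zero_on_pure[OF fin_dim_UNIV assms] .

text \<open>
  Cocommutativity and coantisymmetry are the antisymmetry of \<open>r\<close>, applied to forms with one leg
  acted on. The three laws in \<open>A \<otimes> A \<otimes> A\<close> are read off from the double, where \<open>A\<^sup>*\<close> is the
  subalgebra of the elements \<open>(0, f)\<close>.
\<close>

lemma coalgebra: "relative_poisson_coalgebra scale \<Delta> \<delta> (\<lambda>x. - br one x)"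
proof -
  let ?Q = "\<lambda>x. - br one x"
  have f2: "functional2 scale (\<Delta> x)" "functional2 scale (\<delta> x)" for x
    using cobound_in_tensors2 mult.tensors2_functional2 by blast+
  note f3 = mult.functional3_coproduct[OF coproducts(1) f2(1)]
    mult.functional3_coproduct[OF coproducts(1) f2(2)] mult.functional3_coproduct[OF coproducts(2) f2(1)]
    mult.functional3_coproduct[OF coproducts(2) f2(2)] mult.functional3_add mult.functional3_diff
    mult.functional3_cycle mult.functional3_flip12 mult.functional3_tmap3[OF _ linear_ops(3)]
  note closed = mult.dual_op_closed[OF coproducts(1)] mult.dual_op_closed[OF coproducts(2)]
  note pure = mult.tensor_pure[OF coproducts(1)] mult.tensor_pure[OF coproducts(2)]
  have V: "(0, f) \<in> bowtie_space scale" if "f \<in> dual_space scale" for f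
    using that by (simp add: bowtie_space_def)
  note sub = dual_subalgebra closed
  show ?thesis
  proof (intro relative_poisson_coalgebra.intro[OF mult.fd_space_on_axioms]
      relative_poisson_coalgebra_axioms.intro, goal_cases)
    case (1 x) show ?case by (rule cobound_in_tensors2)
  next
    case 2 show ?case by (rule cobound_linear)
  next
    case (3 x) show ?case by (rule cobound_in_tensors2)
  next
    case 4 show ?case by (rule cobound_linear)
  next
    case 5 show ?case by (rule linear_ops)
  next
    case (6 x)
    show ?case
    proof
      fix \<beta>
      have s: "bilinear_form scale (\<lambda>x y. \<beta> y x) \<longleftrightarrow> bilinear_form scale \<beta>"
        unfolding bilinear_form_def by blast
      show "flip2 (\<Delta> x) \<beta> = \<Delta> x \<beta>"
      proof (cases "bilinear_form scale \<beta>")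
        case True
        then show ?thesis
          using antisym_sum[OF bilinear_form_comp[OF True linear_ops(1)[of x] linear_ops(4)]]
            antisym_sum[OF bilinear_form_comp[OF True linear_ops(4) linear_ops(1)[of x]]] s
          by (simp add: flip2_def \<Delta>_apply sum_subtractf)
      qed (use s in \<open>simp add: flip2_def cobound_outside\<close>)
    qed
  next
    case (7 x)
    have "id_tensor scale \<Delta> (\<Delta> x) - tensor_id scale \<Delta> (\<Delta> x) = 0"
    proof (rule tensor3_zero)
      fix f g h assume d: "f \<in> dual_space scale" "g \<in> dual_space scale" "h \<in> dual_space scale"
      have "dual_op \<Delta> (dual_op \<Delta> f g) h = dual_op \<Delta> f (dual_op \<Delta> g h)"
        using double.mult.mul_assoc[OF V V V, OF d] by (simp add: sub d del: bowtie_mul.simps)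
      then show "(id_tensor scale \<Delta> (\<Delta> x) - tensor_id scale \<Delta> (\<Delta> x)) (\<lambda>x y z. f x * (g y * h z)) = 0"
        by (simp add: pure d)
    qed (intro f3)
    then show ?case by simp
  next
    case (8 x)
    show ?case
    proof
      fix \<beta>
      have s: "bilinear_form scale (\<lambda>x y. \<beta> y x) \<longleftrightarrow> bilinear_form scale \<beta>"
        unfolding bilinear_form_def by blast
      show "flip2 (\<delta> x) \<beta> = (- \<delta> x) \<beta>"
      proof (cases "bilinear_form scale \<beta>")
        case True
        then show ?thesis
          using antisym_sum[OF bilinear_form_comp[OF True linear_ops(2)[of x] linear_ops(4)]]
            antisym_sum[OF bilinear_form_comp[OF True linear_ops(4) linear_ops(2)[of x]]] s
          by (simp add: flip2_def \<delta>_apply sum.distrib)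
      qed (use s in \<open>simp add: flip2_def cobound_outside\<close>)
    qed
  next
    case (9 x)
    show ?case
    proof (rule tensor3_zero)
      fix f g h assume d: "f \<in> dual_space scale" "g \<in> dual_space scale" "h \<in> dual_space scale"
      have c: "(\<lambda>x y z. f y * (g z * h x)) = (\<lambda>x y z. h x * (f y * g z))"
        "(\<lambda>x y z. f z * (g x * h y)) = (\<lambda>x y z. g x * (h y * f z))"
        by (simp_all add: fun_eq_iff mult_ac)
      have "dual_op \<delta> f (dual_op \<delta> g h) + dual_op \<delta> g (dual_op \<delta> h f) + dual_op \<delta> h (dual_op \<delta> f g) = 0"
        using double.lie.jacobi[OF V V V, OF d] by (simp add: sub d zero_prod_def del: bowtie_br.simps)
      from fun_cong[OF this, of x]
      show "(id_tensor scale \<delta> (\<delta> x) + cycle3 (id_tensor scale \<delta> (\<delta> x)) +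
         cycle3 (cycle3 (id_tensor scale \<delta> (\<delta> x)))) (\<lambda>x y z. f x * (g y * h z)) = 0"
        by (simp add: cycle3_def c pure d add_ac)
    qed (intro f3)
  next
    case (10 x)
    have "\<Delta> (- br one x) = - \<Delta> (br one x)"
      by (rule ext) (use mult.coproduct_apply(2)[OF coproducts(1), of "-1" "br one x"] in simp)
    then show ?case by (simp only: cobound_ad_one tmap2_minus_cobound) simp
  next
    case (11 x)
    have "\<delta> (- br one x) = - \<delta> (br one x)"
      by (rule ext) (use mult.coproduct_apply(2)[OF coproducts(2), of "-1" "br one x"] in simp)
    then show ?case by (simp only: cobound_ad_one tmap2_minus_cobound) simp
  next
    case (12 x)
    show ?case
    proof (rule tensor3_zero)
      fix f g h assume d: "f \<in> dual_space scale" "g \<in> dual_space scale" "h \<in> dual_space scale"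
      have Q: "(\<lambda>x. f (?Q x)) \<in> dual_space scale"
        using d(1) by (simp add: mult.dual_space_minus mult.dual_space_iff)
      have tr: "- transpose_map (br one) f = (\<lambda>x. f (?Q x))"
        using d(1) by (simp add: transpose_map_def fun_eq_iff mult.dual_space_minus)
      have c: "(\<lambda>x y z. f y * (g x * h z)) = (\<lambda>x y z. g x * (f y * h z))"
        by (simp_all add: fun_eq_iff mult_ac)
      \<comment> \<open>the last summand of the Leibniz rule contains the bracket of the unit with \<open>(0, f)\<close>, which is
        \<open>(0, f \<circ> Q)\<close>\<close>
      have "dual_op \<delta> f (dual_op \<Delta> g h) = dual_op \<Delta> (dual_op \<delta> f g) h + dual_op \<Delta> g (dual_op \<delta> f h)
          + dual_op \<Delta> (dual_op \<Delta> g h) (\<lambda>x. f (?Q x))"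
        using double.jacobi_leibniz[OF V V V, OF d(2,3,1)]
        by (simp add: sub d Q tr bowtie_ad_one del: bowtie_br.simps bowtie_mul.simps)
      moreover have "dual_op \<Delta> (dual_op \<Delta> g h) (\<lambda>x. f (?Q x)) = dual_op \<Delta> (dual_op \<Delta> (\<lambda>x. f (?Q x)) g) h"
        using double.mult.mul_commute[OF V V, OF closed(1)[of g h] Q]
          double.mult.mul_assoc[OF V V V, OF Q d(2,3)]
        by (simp add: sub d Q del: bowtie_br.simps bowtie_mul.simps)
      ultimately have "dual_op \<delta> f (dual_op \<Delta> g h) x = dual_op \<Delta> (dual_op \<delta> f g) h x
          + dual_op \<Delta> g (dual_op \<delta> f h) x + dual_op \<Delta> (dual_op \<Delta> (\<lambda>x. f (?Q x)) g) h x"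
        by simp
      then show "(id_tensor scale \<Delta> (\<delta> x) - tensor_id scale \<delta> (\<Delta> x) - flip12 (id_tensor scale \<delta> (\<Delta> x)) -
         tmap3 scale ?Q id id (tensor_id scale \<Delta> (\<Delta> x))) (\<lambda>x y z. f x * (g y * h z)) = 0"
        using pure(2)[OF Q d(2,3), of \<Delta> x]
        by (simp add: flip12_def tmap3_def trilinear_pure c pure d)
    qed (intro f3)
  qed
qed

section \<open>The bialgebra\<close>

text \<open>
  The last condition compares the Leibniz expansions of the three cyclic terms: all brackets of two
  of the elements cancel, and the corrections add up to \<open>[1, x y z]\<close>.
\<close>

lemma dual_rep_ad_one: "dually_represents mul br (br one) (\<lambda>x. - br one x)"
  unfolding dually_represents_def
proof (intro conjI allI)
  fix x y z
  show "mul x (- br one y) - mul (br one x) y - - br one (mul x y) = 0"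
    by (simp add: leibniz)
  show "br x (- br one y) - br (br one x) y - - br one (br x y) = 0"
    using jacobi_ad[of one x y] by simp
  show "br x (mul y z) + br y (mul z x) + br z (mul x y) + - br one (mul (mul x y) z) = 0"
    using br_swap[of y x] br_swap[of z x] br_swap[of z y] br_swap[of x one] br_swap[of y one] br_swap[of z one]
    by (simp add: leibniz algebra_simps mul_assoc mul_commute mul_left_commute)
qed

text \<open>
  After evaluation on a bilinear form each identity splits into terms with an operator on the first
  leg of \<open>r\<close>, terms with an operator on the second, and mixed terms. In the identity for
  \<open>\<delta>(x y)\<close> the second-leg terms vanish because \<open>-P\<close> dually represents \<open>A\<close>, and the others combine
  to \<open>- (L(x y) \<otimes> id) (P \<otimes> id + id \<otimes> P) r\<close>, which is \<open>0\<close> by invariance, where \<open>L(u)\<close> is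
  multiplication by \<open>u\<close>. In the identities for \<open>\<Delta>(x y)\<close>, \<open>\<delta>([x, y])\<close> and \<open>\<Delta>([x, y])\<close> the three
  groups cancel separately. The condition on \<open>P + Q\<close> holds since \<open>P + Q = 0\<close>.
\<close>

lemma bialgebra: "relative_poisson_bialgebra scale mul br \<Delta> \<delta> (br one) (\<lambda>x. - br one x)"
proof -
  interpret relative_poisson_algebra_on scale UNIV mul br "br one"
    by (rule relative_poisson_ad_one) simp
  interpret relative_poisson_coalgebra scale \<Delta> \<delta> "\<lambda>x. - br one x"
    by (rule coalgebra)
  note sums = sum.distrib sum_subtractf
  show ?thesis
  proof (unfold_locales, goal_cases)
    case 1 show ?case by (rule dual_rep_ad_one)
  next
    case (2 x) show ?case by (simp only: cobound_ad_one tmap2_minus_cobound) simp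
  next
    case (3 x) show ?case by (simp only: cobound_ad_one tmap2_minus_cobound) simp
  next
    case (4 x)
    have "\<Delta> 0 \<beta> = 0" for \<beta>
      using mult.coproduct_apply(2)[OF coproducts(1), of 0 0 \<beta>] by simp
    then show ?case by (simp add: tensor_id_def fun_eq_iff)
  next
    case (5 x y)
    show ?case
    proof
      fix \<beta>
      show "\<Delta> (mul x y) \<beta> = (tmap2 scale (mul x) id (\<Delta> y) + tmap2 scale id (mul y) (\<Delta> x)) \<beta>"
        by (cases "bilinear_form scale \<beta>") (simp_all add: cobound_outside \<Delta>_apply tmap2_cobound
          linear_ops bilinear_form_simps sums mul_assoc mul_left_commute[of y x])
    qed
  next
    case (6 x y)
    show ?case
    proof
      fix \<beta>
      show "\<delta> (br x y) \<beta> = (tmap2 scale (br x) id (\<delta> y) + tmap2 scale id (br x) (\<delta> y)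
        - (tmap2 scale (br y) id (\<delta> x) + tmap2 scale id (br y) (\<delta> x))) \<beta>"
        by (cases "bilinear_form scale \<beta>") (simp_all add: cobound_outside \<delta>_apply tmap2_cobound
          linear_ops bilinear_form_simps sums jacobi_ad)
    qed
  next
    case (7 x y)
    show ?case
    proof
      fix \<beta>
      show "(\<delta> (mul x y) - tmap2 scale id (br y) (\<Delta> x) - tmap2 scale (mul x) id (\<delta> y)
        - tmap2 scale id (br x) (\<Delta> y) - tmap2 scale (mul y) id (\<delta> x)
        - tmap2 scale id (\<lambda>x. - br one x) (\<Delta> (mul x y))) \<beta> = 0 \<beta>"
      proof (cases "bilinear_form scale \<beta>")
        case True
        have inv: "(\<Sum>i<n. \<beta> (mul (mul x y) (br one (a i))) (b i)) =
            - (\<Sum>i<n. \<beta> (mul (mul x y) (a i)) (br one (b i)))"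
          using ad_one_invariant[OF bilinear_form_comp[OF True linear_ops(1)[of "mul x y"] linear_ops(4)]]
          by (simp add: sum.distrib eq_neg_iff_add_eq_0)
        have dual: "br one (mul (mul x y) z) = br x (mul y z) + br y (mul x z) - br (mul x y) z" for z
          using dual_rep_ad_one[unfolded dually_represents_def, THEN conjunct2, THEN conjunct2,
              rule_format, of x y z] br_swap[of z "mul x y"]
          by (simp add: mul_commute[of z x] algebra_simps)
        show ?thesis
          using True
          by (simp add: \<delta>_apply tmap2_cobound linear_ops bilinear_form_simps sums br_mul_left dual inv)
      qed (simp add: cobound_outside tmap2_cobound linear_ops)
    qed
  next
    case (8 x y)
    show ?case
    proof
      fix \<beta>
      show "(\<Delta> (br x y) - tmap2 scale (mul y) id (\<delta> x) - tmap2 scale id (br x) (\<Delta> y)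
        + tmap2 scale id (mul y) (\<delta> x) - tmap2 scale (br x) id (\<Delta> y) + \<Delta> (mul (br one x) y)) \<beta> = 0 \<beta>"
      proof (cases "bilinear_form scale \<beta>")
        case True
        then show ?thesis
          using br_swap[of x one]
          by (simp add: \<Delta>_apply tmap2_cobound linear_ops bilinear_form_simps sums leibniz
            mul_assoc mul_commute mul_left_commute)
      qed (simp add: cobound_outside tmap2_cobound linear_ops)
    qed
  qed
qed

lemma coboundary_bialgebra:
  "coboundary_relative_poisson_bialgebra scale mul br \<Delta> \<delta> (br one) (\<lambda>x. - br one x)"
proof -
  interpret relative_poisson_bialgebra scale mul br \<Delta> \<delta> "br one" "\<lambda>x. - br one x"
    by (rule bialgebra)
  show ?thesis
    by unfold_locales (use mult.tensors2_sumI r_def in blast)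
qed

end

theorem corollary5p3:
  fixes scale :: "'k::{alg_closed_field, field_char_0} \<Rightarrow> 'a::ab_group_add \<Rightarrow> 'a"
    and mul br :: "'a \<Rightarrow> 'a \<Rightarrow> 'a" and one :: 'a
    and r :: "('a, 'k) tensor2" and \<Delta> \<delta> :: "'a \<Rightarrow> ('a, 'k) tensor2"
  assumes "jacobi_algebra_on scale UNIV mul br one"
    and "r \<in> tensors2 scale"
    and "\<And>x. \<Delta> x = tmap2 scale id (mul x) r - tmap2 scale (mul x) id r"
    and "\<And>x. \<delta> x = tmap2 scale (br x) id r + tmap2 scale id (br x) r"
    and "antisymmetric_tensor r"
    and "rpybe_solution scale mul br (br one) (\<lambda>x. - br one x) r"
  shows "coboundary_relative_poisson_bialgebra scale mul br \<Delta> \<delta> (br one) (\<lambda>x. - br one x) \<and>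
    relative_poisson_algebra_on (bowtie_scale scale) (bowtie_space scale)
      (bowtie_mul scale mul \<Delta>) (bowtie_br scale br \<delta>)
      (map_prod (br one) (\<lambda>f. - transpose_map (br one) f)) \<and>
    (\<exists>e. frobenius_jacobi_algebra_on (bowtie_scale scale) (bowtie_space scale)
        (bowtie_mul scale mul \<Delta>) (bowtie_br scale br \<delta>) e bowtie_form \<and>
      (\<forall>x. \<forall>f\<in>dual_space scale.
        bowtie_br scale br \<delta> e (x, f) = (br one x, - transpose_map (br one) f)))"
proof -
  obtain n :: nat and a b where r: "r = (\<Sum>i<n. pure2 scale (a i) (b i))"
    using assms(2) unfolding tensors2_def by blast
  interpret J: jacobi_algebra scale mul br one
    using assms(1) by (rule jacobi_algebra.intro)
  interpret triangular_jacobi_algebra scale mul br one n a b "\<Sum>i<n. pure2 scale (a i) (b i)"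
    by unfold_locales (use assms(5,6) r in simp_all)
  have D: "\<Delta> = cobound_\<Delta> scale mul (\<Sum>i<n. pure2 scale (a i) (b i))"
    "\<delta> = cobound_\<delta> scale br (\<Sum>i<n. pure2 scale (a i) (b i))"
    by (rule ext; simp add: assms(3,4) cobound_\<Delta>_def cobound_\<delta>_def r)+
  show ?thesis
    unfolding D using coboundary_bialgebra relative_poisson_bowtie frobenius_bowtie bowtie_ad_one
    by blast
qed

end
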